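(* Let $g$ be a positive integer and $p$ a prime with $p\geq 2g+1$. Let $L_{k_3,\dots,k_{2g+1}}\in\mathbb Z[\tfrac12]^{2g+1}$ be the Taylor coefficients at $\lambda=0$ of the function $L(\lambda)$ defined in the context. Let $(k_3,\dots,k_{2g+1})\in\mathbb Z_{\ge0}^{2g-1}$, with $p$-ary expansions $k_i=k_i^0+k_i^1p+\dots+k_i^ap^a$ as in the context. Then: 1. $L_{k_3,\dots,k_{2g+1}}\not\equiv 0 \pmod p$ if and only if the tuple $(k_3,\dots,k_{2g+1})$ is admissible. 2. The tuple $(k_3,\dots,k_{2g+1})$ is admissible if and only if $k_i^j\le\frac{p-1}2$ for all $i,j$ (so that its shift coefficients $(m_0,\dots,m_{a+1})$ are defined) and $(k^j_3,\dots,k^j_{2g+1})\in\Delta^{m_{j+1}}_{m_j}$ for $j=0,\dots,a$. 3. If the tuple $(k_3,\dots,k_{2g+1})$ is admissible, with shift coefficients $(m_0,\dots,m_{a+1})$, then modulo $p$ $$L_{k_3,\dots,k_{2g+1}}\lambda_3^{k_3}\cdots\lambda_{2g+1}^{k_{2g+1}}\equiv(-1)^{a(p-1)/2}\binom{2m_{a+1}}{m_{a+1}}\Big(\prod_{j=1}^aC^{m_{j+1}}_{m_j;\,k_3^j,\dots,k_{2g+1}^j}(\lambda_3^{p^j},\dots,\lambda_{2g+1}^{p^j})\Big)K^{m_1}_{k_3^0,\dots,k_{2g+1}^0}(\lambda_3,\dots,\lambda_{2g+1}).$$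
   Context: The function $L$. For $\lambda=(\lambda_3,\dots,\lambda_{2g+1})\in\mathbb C^{2g-1}$ with all $|\lambda_j|<\frac12$, let $L(\lambda)=(L_1,\dots,L_{2g+1})$ with $$L_j(\lambda)=\frac{-1}{2\pi}\int_{|x|=1/2}\frac{dx}{\sqrt{x(x-1)(x-\lambda_3)\cdots(x-\lambda_{2g+1})}}\,\frac1{x-\lambda_j},$$ where $\lambda_1:=0$, $\lambda_2:=1$, the circle is oriented counter-clockwise, and the branch is $$\frac1{\sqrt{x(x-1)(x-\lambda_3)\cdots(x-\lambda_{2g+1})}}=\sqrt{-1}\,(1-x)^{-1/2}x^{-g}\prod_{i=3}^{2g+1}(1-\lambda_i/x)^{-1/2}$$ with principal branches on the right. Then $L$ is holomorphic at $\lambda=0$, $L(\lambda)=\sum_{k\in\mathbb Z_{\ge0}^{2g-1}}L_{k_3,\dots,k_{2g+1}}\lambda_3^{k_3}\cdots\lambda_{2g+1}^{k_{2g+1}}$, with coefficients in $\mathbb Z[\frac12]^{2g+1}$, which can therefore be reduced modulo $p$. A vector is $\not\equiv0$ mod $p$ if at least one coordinate is. The sets $\Delta^r_s$. For $r=0,\dots,g-1$, $s=0,\dots,g$, $$\Delta^r_s=\Big\{(\ell_3,\dots,\ell_{2g+1})\in\mathbb Z_{\ge0}^{2g-1}\ \Big|\ 0\le\sum_{i=3}^{2g+1}\ell_i+s-rp\le\tfrac{p-1}2,\ \ \ell_i\le\tfrac{p-1}2\text{ for all } i\Big\}.$$ The terms $C$ (terms of entries of the Cartier–Manin matrix of $y^2=x(x-1)\prod_{i\ge3}(x-\lambda_i)$).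 For $r,s\in\{0,\dots,g-1\}$ and $\ell\in\Delta^r_s$, $C^r_{s;\ell}(\lambda)\in\mathbb F_p[\lambda_3,\dots,\lambda_{2g+1}]$ is $$C^r_{s;\ell}(\lambda)=(-1)^{(p-1)/2+rp-s}\binom{(p-1)/2}{\sum_{i=3}^{2g+1}\ell_i+s-rp}\prod_{i=3}^{2g+1}\binom{(p-1)/2}{\ell_i}\lambda_3^{\ell_3}\cdots\lambda_{2g+1}^{\ell_{2g+1}}.$$ The terms $K$. For $m\in\{0,\dots,g-1\}$ and $\ell\in\Delta^m_g$, $K^m_\ell(\lambda)\in\mathbb F_p[\lambda_3,\dots,\lambda_{2g+1}]^{2g+1}$ is $$K^m_\ell(\lambda)=(-1)^{(p-1)/2+mp-g}\binom{(p-1)/2}{\sum_{i=3}^{2g+1}\ell_i+g-mp}\prod_{i=3}^{2g+1}\binom{(p-1)/2}{\ell_i}\lambda_3^{\ell_3}\cdots\lambda_{2g+1}^{\ell_{2g+1}}\Big(1,\,-2\sum_{i=3}^{2g+1}\ell_i-2g,\,2\ell_3+1,\dots,2\ell_{2g+1}+1\Big).$$ Admissibility. Given $(k_3,\dots,k_{2g+1})\in\mathbb Z_{\ge0}^{2g-1}$, write $k_i=k_i^0+k_i^1p+\dots+k_i^ap^a$, $0\le k_i^j\le p-1$, where $a\ge 0$ is such that not all of $k_3^a,\dots,k_{2g+1}^a$ are zero (for the zero tuple take $a=0$). Suppose $k_i^j\le\frac{p-1}2$ for all $i,j$. Then the shift coefficients $(m_0,\dots,m_{a+1})$ are defined recursively: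 $m_0=g$, and for $j=0,\dots,a$, $m_{j+1}$ is the unique integer with $0\le m_{j+1}<g$ and $0\le\sum_{i=3}^{2g+1}k_i^j+m_j-m_{j+1}p<p$. The tuple is called admissible if $k_i^j\le\frac{p-1}2$ for all $i,j$ and its shift coefficients satisfy $\sum_{i=3}^{2g+1}k_i^j-m_{j+1}p+m_j\le\frac{p-1}2$ for $j=0,\dots,a$.
   Formalization: In part 3 the scalar (-1)^{a(p-1)/2} binom(2m,m), m=m_{a+1}, is replaced by (-1)^{(a+1)(p-1)/2} binom(2m,m)/4^m; the printed one fails for g=1, p=3, k=0, where L_0 has first coordinate 1/2 = -1 mod 3 but the printed right side gives 1. *)

theory Defs
  imports
    "HOL-Complex_Analysis.Complex_Analysis"
    "HOL-Library.Poly_Mapping"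
    "Berlekamp_Zassenhaus.Finite_Field"
begin

text \<open>
  Tuples indexed by \<open>3, \<dots>, 2g+1\<close>: multi-indices are finitely supported maps
  \<open>k :: nat \<Rightarrow>\<^sub>0 nat\<close> with \<open>keys k \<subseteq> idx g\<close>; a point of \<open>\<complex>\<close> to the power \<open>2g-1\<close> is a function
  \<open>lam :: nat \<Rightarrow> complex\<close> of which only the values on \<open>idx g\<close> matter.
\<close>

definition idx :: "nat \<Rightarrow> nat set" where
  "idx g = {3..2 * g + 1}"

subsection \<open>The function L and its Taylor coefficients\<close>

definition branch_point :: "(nat \<Rightarrow> complex) \<Rightarrow> nat \<Rightarrow> complex" where
  "branch_point lam j = (if j = 1 then 0 else if j = 2 then 1 else lam j)"

definition inv_sqrt_branch :: "nat \<Rightarrow> (nat \<Rightarrow> complex) \<Rightarrow> complex \<Rightarrow> complex" where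
  "inv_sqrt_branch g lam x =
     \<i> * (1 - x) powr (- 1 / 2) * (1 / x ^ g) * (\<Prod>i\<in>idx g. (1 - lam i / x) powr (- 1 / 2))"

definition L_fun :: "nat \<Rightarrow> nat \<Rightarrow> (nat \<Rightarrow> complex) \<Rightarrow> complex" where
  "L_fun g j lam =
     - 1 / (2 * of_real pi) *
       contour_integral (circlepath 0 (1 / 2))
         (\<lambda>x. inv_sqrt_branch g lam x * (1 / (x - branch_point lam j)))"

definition has_power_series_at_0 ::
    "nat set \<Rightarrow> ((nat \<Rightarrow> complex) \<Rightarrow> complex) \<Rightarrow> ((nat \<Rightarrow>\<^sub>0 nat) \<Rightarrow> complex) \<Rightarrow> bool" where
  "has_power_series_at_0 I f c \<longleftrightarrow>
     (\<exists>r>0. \<forall>lam. (\<forall>i\<in>I. norm (lam i) < r) \<longrightarrow>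
        ((\<lambda>k. c k * (\<Prod>i\<in>I. lam i ^ Poly_Mapping.lookup k i)) has_sum f lam)
          {k. Poly_Mapping.keys k \<subseteq> I})"

definition L_coeff :: "nat \<Rightarrow> (nat \<Rightarrow>\<^sub>0 nat) \<Rightarrow> nat \<Rightarrow> complex" where
  "L_coeff g k j = (THE z. \<exists>c. has_power_series_at_0 (idx g) (L_fun g j) c \<and> z = c k)"

text \<open>The subring \<open>\<int>[1/2]\<close> of \<open>\<complex>\<close> and its reduction map to \<open>\<bbbF>\<^sub>p\<close>, for odd \<open>p = CARD('p)\<close>.\<close>

definition Z_half :: "complex set" where
  "Z_half = {of_int n / 2 ^ e | n e. True}"

definition reduce :: "complex \<Rightarrow> 'p::prime_card mod_ring" where
  "reduce z = (THE r. \<exists>n e. z = of_int n / 2 ^ e \<and> r = of_int n / 2 ^ e)"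

subsection \<open>The sets Delta\<close>

definition tuple_sum :: "nat \<Rightarrow> (nat \<Rightarrow>\<^sub>0 nat) \<Rightarrow> nat" where
  "tuple_sum g l = (\<Sum>i\<in>idx g. Poly_Mapping.lookup l i)"

definition Delta :: "nat \<Rightarrow> nat \<Rightarrow> nat \<Rightarrow> nat \<Rightarrow> (nat \<Rightarrow>\<^sub>0 nat) set" where
  "Delta p g r s =
     {l. Poly_Mapping.keys l \<subseteq> idx g \<and>
         0 \<le> int (tuple_sum g l) + int s - int r * int p \<and>
         int (tuple_sum g l) + int s - int r * int p \<le> int ((p - 1) div 2) \<and>
         (\<forall>i\<in>idx g. Poly_Mapping.lookup l i \<le> (p - 1) div 2)}"

subsection \<open>The terms C and K\<close>

text \<open>
  \<open>\<bbbF>\<^sub>p[\<lambda>\<^sub>3, \<dots>, \<lambda>\<^sub>2\<^sub>g\<^sub>+\<^sub>1]\<close> sits inside the following polynomial ring with variables indexed by all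
  natural numbers.
\<close>

type_synonym 'p Fp_poly = "(nat \<Rightarrow>\<^sub>0 nat) \<Rightarrow>\<^sub>0 'p mod_ring"

definition Const :: "'p::prime_card mod_ring \<Rightarrow> 'p Fp_poly" where
  "Const c = Poly_Mapping.single 0 c"

definition Var :: "nat \<Rightarrow> 'p::prime_card Fp_poly" where
  "Var i = Poly_Mapping.single (Poly_Mapping.single i 1) 1"

text \<open>
  The terms are written as functions of their arguments \<open>x i\<close>, so that the polynomial itself is
  the value at \<open>x = Var\<close>, and substituting the \<open>p^j\<close>-th powers of the variables means taking
  \<open>x = (\<lambda>i. Var i ^ (p ^ j))\<close>. They are used for \<open>l \<in> Delta p g r s\<close>, \<open>s \<le> g\<close> and
  \<open>2 * g + 1 \<le> p\<close>, where no subtraction of natural numbers below truncates.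
\<close>

definition C_term ::
    "nat \<Rightarrow> nat \<Rightarrow> nat \<Rightarrow> nat \<Rightarrow> (nat \<Rightarrow>\<^sub>0 nat) \<Rightarrow> (nat \<Rightarrow> 'p::prime_card Fp_poly) \<Rightarrow> 'p Fp_poly" where
  "C_term p g r s l x =
     (- 1) ^ ((p - 1) div 2 + r * p - s) *
     of_nat (((p - 1) div 2) choose (tuple_sum g l + s - r * p)) *
     of_nat (\<Prod>i\<in>idx g. ((p - 1) div 2) choose (Poly_Mapping.lookup l i)) *
     (\<Prod>i\<in>idx g. x i ^ Poly_Mapping.lookup l i)"

text \<open>The coordinates of \<open>K\<close> are indexed by \<open>j \<in> {1..2 * g + 1}\<close>.\<close>

definition K_term ::
    "nat \<Rightarrow> nat \<Rightarrow> nat \<Rightarrow> (nat \<Rightarrow>\<^sub>0 nat) \<Rightarrow> (nat \<Rightarrow> 'p::prime_card Fp_poly) \<Rightarrow> nat \<Rightarrow> 'p Fp_poly" where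
  "K_term p g m l x j =
     (- 1) ^ ((p - 1) div 2 + m * p - g) *
     of_nat (((p - 1) div 2) choose (tuple_sum g l + g - m * p)) *
     of_nat (\<Prod>i\<in>idx g. ((p - 1) div 2) choose (Poly_Mapping.lookup l i)) *
     (\<Prod>i\<in>idx g. x i ^ Poly_Mapping.lookup l i) *
     (if j = 1 then 1
      else if j = 2 then - 2 * of_nat (tuple_sum g l) - 2 * of_nat g
      else 2 * of_nat (Poly_Mapping.lookup l j) + 1)"

subsection \<open>Shift coefficients and admissibility\<close>

definition digit :: "nat \<Rightarrow> nat \<Rightarrow> nat \<Rightarrow> nat" where
  "digit p n j = n div p ^ j mod p"

definition digit_tuple :: "nat \<Rightarrow> (nat \<Rightarrow>\<^sub>0 nat) \<Rightarrow> nat \<Rightarrow> (nat \<Rightarrow>\<^sub>0 nat)" where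
  "digit_tuple p k j = Poly_Mapping.map (\<lambda>n. digit p n j) k"

definition top_index :: "nat \<Rightarrow> nat \<Rightarrow> (nat \<Rightarrow>\<^sub>0 nat) \<Rightarrow> nat" where
  "top_index p g k =
     (THE a. (\<forall>i\<in>idx g. Poly_Mapping.lookup k i =
                (\<Sum>j\<le>a. digit p (Poly_Mapping.lookup k i) j * p ^ j)) \<and>
             (if \<forall>i\<in>idx g. Poly_Mapping.lookup k i = 0 then a = 0
              else \<exists>i\<in>idx g. digit p (Poly_Mapping.lookup k i) a \<noteq> 0))"

definition small_digits :: "nat \<Rightarrow> nat \<Rightarrow> (nat \<Rightarrow>\<^sub>0 nat) \<Rightarrow> bool" where
  "small_digits p g k \<longleftrightarrow>
     (\<forall>i\<in>idx g. \<forall>j\<le>top_index p g k. digit p (Poly_Mapping.lookup k i) j \<le> (p - 1) div 2)"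

text \<open>Meaningful for indices up to \<open>top_index p g k + 1\<close> when \<open>small_digits p g k\<close>.\<close>

primrec shift_coeff :: "nat \<Rightarrow> nat \<Rightarrow> (nat \<Rightarrow>\<^sub>0 nat) \<Rightarrow> nat \<Rightarrow> nat" where
  "shift_coeff p g k 0 = g"
| "shift_coeff p g k (Suc j) =
     (THE m. m < g \<and>
        0 \<le> int (tuple_sum g (digit_tuple p k j)) + int (shift_coeff p g k j) - int m * int p \<and>
        int (tuple_sum g (digit_tuple p k j)) + int (shift_coeff p g k j) - int m * int p < int p)"

definition admissible :: "nat \<Rightarrow> nat \<Rightarrow> (nat \<Rightarrow>\<^sub>0 nat) \<Rightarrow> bool" where
  "admissible p g k \<longleftrightarrow>
     small_digits p g k \<and>
     (\<forall>j\<le>top_index p g k.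
        int (tuple_sum g (digit_tuple p k j)) - int (shift_coeff p g k (j + 1)) * int p
          + int (shift_coeff p g k j) \<le> int ((p - 1) div 2))"

subsection \<open>The scalar factor in the congruence\<close>

text \<open>
  With top index \<open>a\<close> and last shift coefficient \<open>m\<close>. The source prints this factor as
  \<open>(-1)^(a(p-1)/2) binom(2m,m)\<close>, for which the congruence is false: for \<open>g = 1\<close>, \<open>p = 3\<close>,
  \<open>k = 0\<close> one has \<open>a = m = 0\<close>, first coordinate \<open>1/2\<close> of the Taylor coefficient, and first
  coordinate \<open>1\<close> of \<open>K\<close>, but \<open>1/2 \<equiv> -1\<close> modulo \<open>3\<close>. The exponent must count all \<open>a + 1\<close> factors
  \<open>C, \<dots>, C, K\<close>, each of which contributes a sign \<open>(-1)^((p-1)/2)\<close>. The top digit \<open>m\<close> of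
  \<open>N = k\<^sub>3 + \<dots> + k\<^sub>2\<^sub>g\<^sub>+\<^sub>1 + g\<close> contributes the coefficient \<open>binom(2m,m) / 4^m\<close> of \<open>x^m\<close> in
  \<open>(1-x)^(-1/2)\<close>, including the power of \<open>4\<close>.
\<close>

definition scalar_factor :: "nat \<Rightarrow> nat \<Rightarrow> nat \<Rightarrow> 'p::prime_card mod_ring" where
  "scalar_factor p a m = (- 1) ^ ((a + 1) * ((p - 1) div 2)) * of_nat ((2 * m) choose m) / 4 ^ m"

end

theory Submission
  imports Defs
begin

text \<open>
  Write \<open>u n = binom (2 n) n / 4 ^ n\<close> for the coefficients of \<open>(1 - z) powr (- 1 / 2)\<close>. Expanding the
  factors of the integrand in \<open>\<lambda>\<^sub>i / x\<close> and taking residues gives \<open>L\<^sub>k = u N * (\<Prod>i. u (k\<^sub>i)) * w\<close> with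
  \<open>N = g + (\<Sum>i. k\<^sub>i)\<close> and an integral weight vector \<open>w\<close> with first entry 1. By Lucas,
  \<open>u (n + p q) \<equiv> u n * u q\<close> modulo \<open>p\<close> for \<open>n < p\<close>, and \<open>u n \<equiv> (-1) ^ n * binom ((p - 1) div 2) n\<close>
  there, which vanishes exactly for \<open>n > (p - 1) div 2\<close>. The shift coefficients are the carries in the
  base \<open>p\<close> addition \<open>g + (\<Sum>i. k\<^sub>i)\<close>, so multiplying over the digits of \<open>N\<close> and of the \<open>k\<^sub>i\<close> gives one
  factor \<open>C\<close> or \<open>K\<close> per position and a last factor \<open>u\<close> at the top digit of \<open>N\<close>.
\<close>

subsection \<open>Power series in several variables\<close>

text \<open>Splitting off the exponent of one variable turns a sum over multi-indices into a double
  sum; both inductions on the set of variables rest on this.\<close>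

lemma bij_betw_add_single:
  assumes "i \<notin> I"
  shows "bij_betw (\<lambda>(n, k). k + Poly_Mapping.single i n)
           (UNIV \<times> {k :: 'i \<Rightarrow>\<^sub>0 nat. Poly_Mapping.keys k \<subseteq> I})
           {k. Poly_Mapping.keys k \<subseteq> insert i I}"
proof (rule bij_betwI[where g = "\<lambda>k. (Poly_Mapping.lookup k i,
      k - Poly_Mapping.single i (Poly_Mapping.lookup k i))"])
  show "(\<lambda>(n, k). k + Poly_Mapping.single i n)
      \<in> UNIV \<times> {k :: 'i \<Rightarrow>\<^sub>0 nat. Poly_Mapping.keys k \<subseteq> I} \<rightarrow> {k. Poly_Mapping.keys k \<subseteq> insert i I}"
    by (auto simp: in_keys_iff subset_iff lookup_add lookup_single when_def split: if_splits)
  show "(\<lambda>k. (Poly_Mapping.lookup k i, k - Poly_Mapping.single i (Poly_Mapping.lookup k i)))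
      \<in> {k. Poly_Mapping.keys k \<subseteq> insert i I} \<rightarrow> UNIV \<times> {k. Poly_Mapping.keys k \<subseteq> I}"
    by (auto simp: in_keys_iff subset_iff lookup_minus lookup_single when_def split: if_splits)
qed (use assms in \<open>force intro!: poly_mapping_eqI
       simp: lookup_add lookup_minus lookup_single when_def in_keys_iff subset_iff\<close>)+

lemma lookup_add_single:
  assumes "i \<notin> I" "Poly_Mapping.keys k \<subseteq> I"
  shows "Poly_Mapping.lookup (k + Poly_Mapping.single i (n :: nat)) i = n"
    and "j \<in> I \<Longrightarrow> Poly_Mapping.lookup (k + Poly_Mapping.single i n) j = Poly_Mapping.lookup k j"
  using assms by (auto simp: lookup_add lookup_single when_def in_keys_iff)

lemma prod_add_single:
  assumes "finite I" "i \<notin> I" "Poly_Mapping.keys k \<subseteq> I"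
  shows "(\<Prod>j\<in>insert i I. h j (Poly_Mapping.lookup (k + Poly_Mapping.single i (n :: nat)) j)) =
         h i n * (\<Prod>j\<in>I. h j (Poly_Mapping.lookup k j))"
  using assms by (simp add: lookup_add_single[OF assms(2,3)] cong: prod.cong)

lemma keys_subset_empty: "{k. Poly_Mapping.keys k \<subseteq> {}} = {0}"
  by auto

text \<open>Multiplying out finitely many absolutely convergent series, one series per induction
  step. Absolute summability is kept in the conclusion because convergent iterated sums alone would
  not give summability on the product set.\<close>

lemma has_sum_prod_poly_mapping:
  fixes h :: "'i \<Rightarrow> nat \<Rightarrow> 'a :: {real_normed_field, banach}"
  assumes "finite I"
    and "\<And>i. i \<in> I \<Longrightarrow> summable (\<lambda>n. norm (h i n))"
    and "\<And>i. i \<in> I \<Longrightarrow> h i sums s i"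
  shows "(\<lambda>k. norm (\<Prod>i\<in>I. h i (Poly_Mapping.lookup k i))) summable_on {k. Poly_Mapping.keys k \<subseteq> I}
    \<and> ((\<lambda>k. \<Prod>i\<in>I. h i (Poly_Mapping.lookup k i)) has_sum (\<Prod>i\<in>I. s i))
        {k. Poly_Mapping.keys k \<subseteq> I}"
  using assms
proof (induction I rule: finite_induct)
  case empty
  show ?case by (simp add: keys_subset_empty has_sum_finiteI)
next
  case (insert i I)
  let ?S = "{k :: 'i \<Rightarrow>\<^sub>0 nat. Poly_Mapping.keys k \<subseteq> I}"
  let ?P = "\<lambda>k :: 'i \<Rightarrow>\<^sub>0 nat. \<Prod>i\<in>I. h i (Poly_Mapping.lookup k i)"
  let ?G = "\<lambda>k :: 'i \<Rightarrow>\<^sub>0 nat. \<Prod>j\<in>insert i I. h j (Poly_Mapping.lookup k j)"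
  have IH: "(\<lambda>k. norm (?P k)) summable_on ?S" "(?P has_sum (\<Prod>i\<in>I. s i)) ?S"
    using insert by auto
  have hi: "((\<lambda>n. norm (h i n)) has_sum suminf (\<lambda>n. norm (h i n))) UNIV" "(h i has_sum s i) UNIV"
    using insert.prems[of i] norm_summable_imp_has_sum[of "h i"]
      norm_summable_imp_has_sum[of "\<lambda>n. norm (h i n)"] by auto
  have bij: "bij_betw (\<lambda>(n, k). k + Poly_Mapping.single i n) (UNIV \<times> ?S)
      {k. Poly_Mapping.keys k \<subseteq> insert i I}"
    using insert.hyps by (intro bij_betw_add_single)
  have G: "?G (case x of (n, k) \<Rightarrow> k + Poly_Mapping.single i n) = h i (fst x) * ?P (snd x)"
    if "x \<in> UNIV \<times> ?S" for x
    using that prod_add_single[OF insert.hyps, of _ h] by (auto split: prod.splits)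
  have nsum: "(\<lambda>x. norm (h i (fst x) * ?P (snd x))) summable_on UNIV \<times> ?S"
  proof (rule summable_on_SigmaI)
    show "((\<lambda>k. norm (h i (fst (n, k)) * ?P (snd (n, k)))) has_sum
        norm (h i n) * infsum (\<lambda>k. norm (?P k)) ?S) ?S" for n
      using has_sum_cmult_right[OF has_sum_infsum[OF IH(1)], of "norm (h i n)"]
      by (simp add: norm_mult)
    show "(\<lambda>n. norm (h i n) * infsum (\<lambda>k. norm (?P k)) ?S) summable_on UNIV"
      using has_sum_imp_summable[OF has_sum_cmult_left[OF hi(1)]] .
  qed auto
  have "((\<lambda>x. h i (fst x) * ?P (snd x)) has_sum (s i * (\<Prod>i\<in>I. s i))) (UNIV \<times> ?S)"
  proof (rule has_sum_SigmaI)
    show "((\<lambda>k. h i (fst (n, k)) * ?P (snd (n, k))) has_sum h i n * (\<Prod>i\<in>I. s i)) ?S" for n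
      using has_sum_cmult_right[OF IH(2), of "h i n"] by simp
    show "((\<lambda>n. h i n * (\<Prod>i\<in>I. s i)) has_sum s i * (\<Prod>i\<in>I. s i)) UNIV"
      using has_sum_cmult_left[OF hi(2)] .
    show "(\<lambda>x. h i (fst x) * ?P (snd x)) summable_on UNIV \<times> ?S"
      using abs_summable_summable[OF nsum] .
  qed
  hence "(?G has_sum (s i * (\<Prod>i\<in>I. s i))) {k. Poly_Mapping.keys k \<subseteq> insert i I}"
    unfolding has_sum_reindex_bij_betw[OF bij, of ?G, symmetric]
    by (rule has_sum_cong[THEN iffD1, rotated]) (simp only: G)
  moreover have "(\<lambda>k. norm (?G k)) summable_on {k. Poly_Mapping.keys k \<subseteq> insert i I}"
    unfolding summable_on_reindex_bij_betw[OF bij, of "\<lambda>k. norm (?G k)", symmetric]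
    by (rule summable_on_cong[THEN iffD1, OF _ nsum]) (simp only: G)
  ultimately show ?case
    using insert.hyps by simp
qed

section \<open>Identity theorem for power series\<close>

lemma powser_sums_zero_imp_coeff_eq_0:
  fixes b :: "nat \<Rightarrow> complex"
  assumes "r > 0" "\<And>z. norm z < r \<Longrightarrow> (\<lambda>n. b n * z ^ n) sums 0"
  shows "b n = 0"
proof -
  have "(\<lambda>_ :: complex. 0 :: complex) has_fps_expansion Abs_fps b"
  proof (rule has_fps_expansionI)
    have "eventually (\<lambda>z :: complex. z \<in> ball 0 r) (nhds 0)"
      using assms(1) by (intro eventually_nhds_in_open) auto
    thus "eventually (\<lambda>z. (\<lambda>n. fps_nth (Abs_fps b) n * z ^ n) sums 0) (nhds 0)"
      by eventually_elim (use assms(2) in simp)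
  qed
  from fps_nth_fps_expansion[OF this, of n] show ?thesis
    by (cases n) auto
qed

text \<open>With all variables but one fixed, the one-variable identity theorem shows that the sum
  attached to each power of the free variable vanishes. These sums are power series in the remaining
  variables, to which the induction hypothesis applies.\<close>

lemma multivariate_power_series_zero_imp_coeff_eq_0:
  fixes c :: "('i \<Rightarrow>\<^sub>0 nat) \<Rightarrow> complex"
  assumes "finite I" "r > 0"
    and "\<And>lam. (\<And>i. i \<in> I \<Longrightarrow> norm (lam i) < r) \<Longrightarrow>
        ((\<lambda>k. c k * (\<Prod>i\<in>I. lam i ^ Poly_Mapping.lookup k i)) has_sum 0)
          {k. Poly_Mapping.keys k \<subseteq> I}"
    and "Poly_Mapping.keys k \<subseteq> I"
  shows "c k = 0"
  using assms(1,3,4)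
proof (induction I arbitrary: c k rule: finite_induct)
  case empty
  have "(c has_sum 0) {0}"
    using empty.prems(1) by (simp add: keys_subset_empty)
  hence "c 0 = 0"
    using has_sum_unique[OF _ has_sum_finiteI[OF _ refl, of "{0}" c]] by simp
  thus ?case using empty.prems by simp
next
  case (insert i I)
  let ?S = "{k :: 'i \<Rightarrow>\<^sub>0 nat. Poly_Mapping.keys k \<subseteq> I}"
  have bij: "bij_betw (\<lambda>(n, k). k + Poly_Mapping.single i n) (UNIV \<times> ?S)
      {k. Poly_Mapping.keys k \<subseteq> insert i I}"
    using insert.hyps by (intro bij_betw_add_single)
  have slice: "c (l + Poly_Mapping.single i n) = 0" if l: "Poly_Mapping.keys l \<subseteq> I" for l n
  proof (rule insert.IH[where c = "\<lambda>l. c (l + Poly_Mapping.single i n)", OF _ l])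
    fix lam :: "'i \<Rightarrow> complex"
    assume lam: "\<And>j. j \<in> I \<Longrightarrow> norm (lam j) < r"
    let ?t = "\<lambda>n k. c (k + Poly_Mapping.single i n) * (\<Prod>j\<in>I. lam j ^ Poly_Mapping.lookup k j)"
    have total: "((\<lambda>(n, k). ?t n k * z ^ n) has_sum 0) (UNIV \<times> ?S)" if z: "norm z < r" for z
    proof -
      let ?lam = "lam(i := z)"
      let ?G = "\<lambda>k. c k * (\<Prod>j\<in>insert i I. ?lam j ^ Poly_Mapping.lookup k j)"
      have "(?G has_sum 0) {k. Poly_Mapping.keys k \<subseteq> insert i I}"
        using z lam by (intro insert.prems(1)) auto
      hence "((\<lambda>x. ?G (case x of (n, k) \<Rightarrow> k + Poly_Mapping.single i n)) has_sum 0) (UNIV \<times> ?S)"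
        by (simp only: has_sum_reindex_bij_betw[OF bij, of ?G 0])
      moreover have "?G (case x of (n, k) \<Rightarrow> k + Poly_Mapping.single i n) =
          (case x of (n, k) \<Rightarrow> ?t n k * z ^ n)" if "x \<in> UNIV \<times> ?S" for x
      proof -
        obtain n k where x: "x = (n, k)" by force
        have "(\<Prod>j\<in>insert i I. ?lam j ^ Poly_Mapping.lookup (k + Poly_Mapping.single i n) j) =
            z ^ n * (\<Prod>j\<in>I. ?lam j ^ Poly_Mapping.lookup k j)"
          using that x prod_add_single[OF insert.hyps, of k "\<lambda>j m. ?lam j ^ m" n] by simp
        also have "(\<Prod>j\<in>I. ?lam j ^ Poly_Mapping.lookup k j) =
            (\<Prod>j\<in>I. lam j ^ Poly_Mapping.lookup k j)"
          using insert.hyps by (intro prod.cong) auto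
        finally show ?thesis using x by (simp add: mult_ac)
      qed
      ultimately show ?thesis
        by (rule has_sum_cong[THEN iffD1, rotated])
    qed
    \<comment> \<open>The nonzero point \<open>z = r / 2\<close> lies in the disc, so the slice is
      summable up to the factor \<open>(r / 2) ^ n\<close>, which is then divided out.\<close>
    have inner: "?t n summable_on ?S" for n
    proof -
      have "(\<lambda>k. ?t n k * of_real (r / 2) ^ n) summable_on ?S"
        by (rule summable_on_SigmaD1[where f = "\<lambda>n k. ?t n k * of_real (r / 2) ^ n" and A = UNIV])
          (use has_sum_imp_summable[OF total[of "of_real (r / 2)"]] \<open>r > 0\<close> in auto)
      hence "(\<lambda>k. ?t n k * of_real (r / 2) ^ n * inverse (of_real (r / 2) ^ n)) summable_on ?S"
        by (rule summable_on_cmult_left)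
      thus ?thesis using \<open>r > 0\<close> by (simp add: mult.assoc del: of_real_divide)
    qed
    have "infsum (?t n) ?S = 0" for n
    proof (rule powser_sums_zero_imp_coeff_eq_0[OF \<open>r > 0\<close>])
      fix z :: complex assume "norm z < r"
      have "((\<lambda>n. infsum (?t n) ?S * z ^ n) has_sum 0) UNIV"
      proof (rule has_sum_SigmaD[OF total[OF \<open>norm z < r\<close>]])
        show "((\<lambda>k. case (n, k) of (n, k) \<Rightarrow> ?t n k * z ^ n) has_sum infsum (?t n) ?S * z ^ n) ?S" for n
          using has_sum_cmult_left[OF has_sum_infsum[OF inner]] by simp
      qed
      thus "(\<lambda>n. infsum (?t n) ?S * z ^ n) sums 0"
        by (rule has_sum_imp_sums)
    qed
    thus "((\<lambda>k. ?t n k) has_sum 0) ?S"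
      using has_sum_infsum[OF inner[of n]] by simp
  qed
  have "k \<in> (\<lambda>(n, k). k + Poly_Mapping.single i n) ` (UNIV \<times> ?S)"
    using bij insert.prems(2) by (simp add: bij_betw_def)
  thus ?case using slice by auto
qed

text \<open>On the smaller of the two polydiscs the difference of the series sums to 0. This is what
  pins down the \<open>THE\<close> in \<open>L_coeff\<close>.\<close>

lemma has_power_series_at_0_unique:
  assumes "finite I" "has_power_series_at_0 I f c" "has_power_series_at_0 I f d"
    and "Poly_Mapping.keys k \<subseteq> I"
  shows "c k = d k"
proof -
  from assms(2) obtain r1 where "r1 > 0" and
    c: "\<And>lam. \<forall>i\<in>I. norm (lam i) < r1 \<Longrightarrow>
      ((\<lambda>k. c k * (\<Prod>i\<in>I. lam i ^ Poly_Mapping.lookup k i)) has_sum f lam)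
        {k. Poly_Mapping.keys k \<subseteq> I}"
    unfolding has_power_series_at_0_def by blast
  from assms(3) obtain r2 where "r2 > 0" and
    d: "\<And>lam. \<forall>i\<in>I. norm (lam i) < r2 \<Longrightarrow>
      ((\<lambda>k. d k * (\<Prod>i\<in>I. lam i ^ Poly_Mapping.lookup k i)) has_sum f lam)
        {k. Poly_Mapping.keys k \<subseteq> I}"
    unfolding has_power_series_at_0_def by blast
  have "c k - d k = 0"
  proof (rule multivariate_power_series_zero_imp_coeff_eq_0[OF assms(1) _ _ assms(4)])
    show "min r1 r2 > 0" using \<open>r1 > 0\<close> \<open>r2 > 0\<close> by simp
    fix lam :: "nat \<Rightarrow> complex" assume "\<And>i. i \<in> I \<Longrightarrow> norm (lam i) < min r1 r2"
    hence "\<forall>i\<in>I. norm (lam i) < r1" "\<forall>i\<in>I. norm (lam i) < r2" by auto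
    from has_sum_add[OF c[OF this(1)] has_sum_cmult_right[OF d[OF this(2)], of "- 1"]]
    show "((\<lambda>k. (c k - d k) * (\<Prod>i\<in>I. lam i ^ Poly_Mapping.lookup k i)) has_sum 0)
        {k. Poly_Mapping.keys k \<subseteq> I}"
      by (simp add: left_diff_distrib)
  qed
  thus ?thesis by simp
qed

subsection \<open>The Taylor coefficients of \<open>L\<close>\<close>

text \<open>The coefficient of \<open>z ^ n\<close> in \<open>(1 - z) powr (- a)\<close>. The value
  \<open>a = 1 / 2\<close> comes from the square root, and \<open>a = 3 / 2\<close> from a factor
  that also absorbs \<open>1 / (x - branch_point lam j)\<close>.\<close>

definition neg_binom :: "complex \<Rightarrow> nat \<Rightarrow> complex" where
  "neg_binom a n = pochhammer a n / fact n"

lemma neg_binom_sums: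
  assumes "norm z < 1"
  shows "(\<lambda>n. neg_binom a n * z ^ n) sums ((1 - z) powr (- a))"
proof -
  have "((- a) gchoose n) * (- z) ^ n = neg_binom a n * z ^ n" for n
  proof -
    have "(- 1) ^ n * (- z) ^ n = z ^ n"
      by (simp flip: power_mult_distrib)
    thus ?thesis
      by (simp add: gbinomial_pochhammer neg_binom_def mult_ac)
  qed
  thus ?thesis
    using gen_binomial_complex[of "- z" "- a"] assms by simp
qed

text \<open>A power series that converges at a radius strictly between \<open>norm z\<close> and 1
  converges absolutely at \<open>z\<close>.\<close>

lemma neg_binom_abs_summable:
  assumes "norm z < 1"
  shows "summable (\<lambda>n. norm (neg_binom a n * z ^ n))"
proof -
  obtain r where r: "norm z < r" "r < 1" using dense[OF assms] by blast
  hence "0 < r" using norm_ge_zero[of z] by linarith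
  have "summable (\<lambda>n. neg_binom a n * (of_real r :: complex) ^ n)"
    using neg_binom_sums[of "of_real r" a] \<open>0 < r\<close> r(2) by (auto intro: sums_summable)
  thus ?thesis
    by (rule powser_insidea) (use r \<open>0 < r\<close> in auto)
qed

text \<open>The factor 1/2 of \<open>pochhammer (1 / 2) (Suc n)\<close> is split off at one end, the
  factor \<open>1 / 2 + n\<close> at the other. The result is the source of the weights
  \<open>2 * k j + 1\<close>.\<close>

lemma neg_binom_three_halves: "neg_binom (3 / 2) n = (2 * of_nat n + 1) * neg_binom (1 / 2) n"
proof -
  have "(1 / 2 :: complex) * pochhammer (1 / 2 + 1) n = pochhammer (1 / 2) n * (1 / 2 + of_nat n)"
    using pochhammer_rec[of "1 / 2 :: complex" n] pochhammer_Suc[of "1 / 2 :: complex" n] by simp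
  thus ?thesis
    by (simp add: neg_binom_def field_simps)
qed

text \<open>In terms of series, \<open>(1 - z) powr (- 3 / 2)\<close> is twice the derivative of
  \<open>(1 - z) powr (- 1 / 2)\<close>. This gives the second weight, a multiple of
  \<open>N\<close>.\<close>

lemma neg_binom_half_Suc: "neg_binom (3 / 2) n = 2 * of_nat (Suc n) * neg_binom (1 / 2) (Suc n)"
proof -
  have "pochhammer (1 / 2 :: complex) (Suc n) = (1 / 2) * pochhammer (3 / 2) n"
    by (simp add: pochhammer_rec)
  thus ?thesis
    by (simp add: neg_binom_def field_simps del: of_nat_Suc)
qed

lemma neg_binom_half: "neg_binom (1 / 2) n = of_nat ((2 * n) choose n) / 4 ^ n"
proof -
  have "(of_nat ((2 * n) choose n) :: complex) = fact (2 * n) / (fact n * fact n)"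
    using binomial_fact[of n "2 * n", where 'a = complex] by simp
  also have "\<dots> = 4 ^ n * neg_binom (1 / 2) n"
    by (simp add: fact_double neg_binom_def power_mult)
  finally show ?thesis by simp
qed

section \<open>Termwise integration over the circle\<close>

lemma one_minus_notin_nonpos_Reals:
  fixes z :: complex
  assumes "norm z < 1"
  shows "1 - z \<notin> \<real>\<^sub>\<le>\<^sub>0"
proof
  assume "1 - z \<in> \<real>\<^sub>\<le>\<^sub>0"
  hence "Re z \<ge> 1" by (simp add: complex_nonpos_Reals_iff)
  thus False using assms complex_Re_le_cmod[of z] by simp
qed

text \<open>Cauchy's formula for the \<open>n\<close>-th derivative at 0, whose value is read off
  the binomial series.\<close>

lemma contour_integral_neg_binom:
  "((\<lambda>x. (1 - x) powr (- b) / x ^ Suc n) has_contour_integral (2 * pi * \<i>) * neg_binom b n)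
     (circlepath 0 (1 / 2))"
proof -
  have "(\<lambda>x. (1 - x) powr (- b)) has_fps_expansion Abs_fps (neg_binom b)"
  proof (rule has_fps_expansionI)
    have "eventually (\<lambda>z :: complex. z \<in> ball 0 1) (nhds 0)"
      by (intro eventually_nhds_in_open) auto
    thus "eventually (\<lambda>z. (\<lambda>n. fps_nth (Abs_fps (neg_binom b)) n * z ^ n) sums (1 - z) powr (- b))
        (nhds 0)"
      by eventually_elim (simp add: neg_binom_sums)
  qed
  from fps_nth_fps_expansion[OF this, of n]
  have coeff: "neg_binom b n = (deriv ^^ n) (\<lambda>x. (1 - x) powr (- b)) 0 / fact n"
    by simp
  have "(\<lambda>x. (1 - x) powr (- b)) holomorphic_on cball 0 (1 / 2)"
    by (intro holomorphic_intros one_minus_notin_nonpos_Reals) auto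
  hence "continuous_on (cball 0 (1 / 2)) (\<lambda>x. (1 - x) powr (- b))"
    "(\<lambda>x. (1 - x) powr (- b)) holomorphic_on ball 0 (1 / 2)"
    by (auto intro: holomorphic_on_imp_continuous_on elim!: holomorphic_on_subset)
  from Cauchy_has_contour_integral_higher_derivative_circlepath[OF this, of 0 n]
  show ?thesis by (simp add: coeff)
qed

text \<open>Each factor is expanded in \<open>lam i / x\<close>. The expansion converges uniformly
  on the contour, so it may be integrated term by term.\<close>

lemma contour_integral_prod_power_series:
  fixes a :: "nat \<Rightarrow> complex"
  assumes "finite I"
  shows "has_power_series_at_0 I
    (\<lambda>lam. contour_integral (circlepath 0 (1 / 2))
       (\<lambda>x. (1 - x) powr (- b) / x ^ Suc n * (\<Prod>i\<in>I. (1 - lam i / x) powr (- a i))))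
    (\<lambda>k. 2 * pi * \<i> * neg_binom b (n + (\<Sum>i\<in>I. Poly_Mapping.lookup k i)) *
         (\<Prod>i\<in>I. neg_binom (a i) (Poly_Mapping.lookup k i)))"
  unfolding has_power_series_at_0_def
\<comment> \<open>The radius 1/4 is half that of the contour, so the ratios \<open>lam i / x\<close>
  stay at most 1/2 in modulus.\<close>
proof (intro exI[of _ "1 / 4 :: real"] conjI allI impI)
  fix lam :: "nat \<Rightarrow> complex"
  assume "\<forall>i\<in>I. norm (lam i) < 1 / 4"
  hence lam: "norm (lam i) \<le> 1 / 4" if "i \<in> I" for i using that by force
  let ?C = "circlepath 0 (1 / 2)"
  let ?S = "{k :: nat \<Rightarrow>\<^sub>0 nat. Poly_Mapping.keys k \<subseteq> I}"
  let ?F = "\<lambda>x. (1 - x) powr (- b) / x ^ Suc n"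
  let ?l = "\<lambda>x. ?F x * (\<Prod>i\<in>I. (1 - lam i / x) powr (- a i))"
  let ?T = "\<lambda>(k :: nat \<Rightarrow>\<^sub>0 nat) x. ?F x *
    (\<Prod>i\<in>I. neg_binom (a i) (Poly_Mapping.lookup k i) * (lam i / x) ^ Poly_Mapping.lookup k i)"
  let ?c = "\<lambda>k. 2 * pi * \<i> * neg_binom b (n + (\<Sum>i\<in>I. Poly_Mapping.lookup k i)) *
    (\<Prod>i\<in>I. neg_binom (a i) (Poly_Mapping.lookup k i)) * (\<Prod>i\<in>I. lam i ^ Poly_Mapping.lookup k i)"
  have T_integral: "(?T k has_contour_integral ?c k) ?C" for k
  proof -
    let ?c' = "(\<Prod>i\<in>I. neg_binom (a i) (Poly_Mapping.lookup k i)) *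
      (\<Prod>i\<in>I. lam i ^ Poly_Mapping.lookup k i)"
    let ?m = "n + (\<Sum>i\<in>I. Poly_Mapping.lookup k i)"
    \<comment> \<open>The powers of \<open>1 / x\<close> from all factors only raise the order of
      the pole, by the sum of the exponents.\<close>
    have "?T k = (\<lambda>x. ?c' * ((1 - x) powr (- b) / x ^ Suc ?m))"
      by (rule ext) (simp add: prod.distrib prod_dividef power_divide power_sum power_add mult_ac)
    moreover have "((\<lambda>x. ?c' * ((1 - x) powr (- b) / x ^ Suc ?m)) has_contour_integral
        ?c' * (2 * pi * \<i> * neg_binom b ?m)) ?C"
      by (rule has_contour_integral_lmul[OF contour_integral_neg_binom])
    moreover have "?c' * (2 * pi * \<i> * neg_binom b ?m) = ?c k"
      by (simp add: mult_ac)
    ultimately show ?thesis by (simp only:)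
  qed
  have "continuous_on (sphere 0 (1 / 2)) ?F"
    by (intro holomorphic_on_imp_continuous_on holomorphic_intros one_minus_notin_nonpos_Reals) auto
  hence "bounded (?F ` sphere 0 (1 / 2))"
    by (intro compact_imp_bounded compact_continuous_image) auto
  then obtain B where B: "\<And>x. x \<in> sphere 0 (1 / 2) \<Longrightarrow> norm (?F x) \<le> B"
    unfolding bounded_iff by blast
  \<comment> \<open>The majorant is the same product series with every ratio replaced by 1/2, hence
    independent of \<open>x\<close>.\<close>
  let ?M = "\<lambda>k :: nat \<Rightarrow>\<^sub>0 nat. B * norm (\<Prod>i\<in>I. neg_binom (a i) (Poly_Mapping.lookup k i) *
      (1 / 2) ^ Poly_Mapping.lookup k i)"
  have M: "?M summable_on ?S"
    using has_sum_prod_poly_mapping[OF assms neg_binom_abs_summable neg_binom_sums, of "\<lambda>_. 1 / 2" a]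
    by (intro summable_on_cmult_right) auto
  have ratio: "norm (lam i / x) \<le> 1 / 2" if "x \<in> sphere 0 (1 / 2)" "i \<in> I" for x i
  proof -
    have "norm x = 1 / 2" using that(1) by simp
    thus ?thesis using lam[OF that(2)] by (simp only: norm_divide) simp
  qed
  have unif: "uniform_limit (sphere 0 (1 / 2)) (\<lambda>X x. \<Sum>k\<in>X. ?T k x) ?l (finite_subsets_at_top ?S)"
  proof (rule Weierstrass_m_test_general'[OF _ _ M])
    fix k :: "nat \<Rightarrow>\<^sub>0 nat" and x :: complex assume x: "x \<in> sphere 0 (1 / 2)"
    have "norm (?T k x) = norm (?F x) * (\<Prod>i\<in>I. norm (neg_binom (a i) (Poly_Mapping.lookup k i)) *
        norm (lam i / x) ^ Poly_Mapping.lookup k i)"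
      by (simp only: norm_mult prod_norm[symmetric] norm_power)
    also have "\<dots> \<le> B * (\<Prod>i\<in>I. norm (neg_binom (a i) (Poly_Mapping.lookup k i)) *
        (1 / 2) ^ Poly_Mapping.lookup k i)"
    proof (rule mult_mono[OF B[OF x]])
      show "0 \<le> B" using B[OF x] norm_ge_zero order_trans by blast
      show "(\<Prod>i\<in>I. norm (neg_binom (a i) (Poly_Mapping.lookup k i)) *
          norm (lam i / x) ^ Poly_Mapping.lookup k i) \<le>
        (\<Prod>i\<in>I. norm (neg_binom (a i) (Poly_Mapping.lookup k i)) * (1 / 2) ^ Poly_Mapping.lookup k i)"
        using ratio[OF x] by (intro prod_mono conjI mult_left_mono power_mono) auto
    qed (auto intro!: prod_nonneg)
    also have "\<dots> = ?M k"
      by (simp add: norm_mult norm_power flip: prod_norm)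
    finally show "norm (?T k x) \<le> ?M k" .
  next
    fix x :: complex assume x: "x \<in> sphere 0 (1 / 2)"
    have *: "norm (lam i / x) < 1" if "i \<in> I" for i
      using ratio[OF x that] by linarith
    show "((\<lambda>k. ?T k x) has_sum ?l x) ?S"
      using has_sum_prod_poly_mapping[of I "\<lambda>i n. neg_binom (a i) n * (lam i / x) ^ n"
          "\<lambda>i. (1 - lam i / x) powr (- a i)", OF assms neg_binom_abs_summable[OF *]
          neg_binom_sums[OF *]]
      by (intro has_sum_cmult_right) auto
  qed
  have "((\<lambda>X. contour_integral ?C (\<lambda>x. \<Sum>k\<in>X. ?T k x)) \<longlongrightarrow> contour_integral ?C ?l)
      (finite_subsets_at_top ?S)"
  proof (rule contour_integral_uniform_limit_circlepath(2)[OF _ unif])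
    show "eventually (\<lambda>X. (\<lambda>x. \<Sum>k\<in>X. ?T k x) contour_integrable_on ?C) (finite_subsets_at_top ?S)"
      by (intro eventually_finite_subsets_at_top_weakI contour_integrable_sum
          has_contour_integral_integrable[OF T_integral])
  qed auto
  moreover have "eventually (\<lambda>X. contour_integral ?C (\<lambda>x. \<Sum>k\<in>X. ?T k x) = (\<Sum>k\<in>X. ?c k))
      (finite_subsets_at_top ?S)"
    by (intro eventually_finite_subsets_at_top_weakI contour_integral_unique
        has_contour_integral_sum T_integral)
  ultimately show "(?c has_sum contour_integral ?C ?l) ?S"
    unfolding has_sum_def by (rule Lim_transform_eventually)
qed auto

section \<open>Closed form of the Taylor coefficients of \<open>L_fun\<close>\<close>

lemma has_power_series_at_0_cmult:
  assumes "has_power_series_at_0 I f c"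
  shows "has_power_series_at_0 I (\<lambda>lam. z * f lam) (\<lambda>k. z * c k)"
  using assms unfolding has_power_series_at_0_def
  by (auto simp: mult.assoc intro!: has_sum_cmult_right)

lemma has_power_series_at_0_transfer:
  assumes "has_power_series_at_0 I f c" "r > 0"
    and "\<And>lam. \<forall>i\<in>I. norm (lam i) < r \<Longrightarrow> f' lam = f lam"
    and "\<And>k. Poly_Mapping.keys k \<subseteq> I \<Longrightarrow> c' k = c k"
  shows "has_power_series_at_0 I f' c'"
proof -
  from assms(1) obtain s where "s > 0" and
    s: "\<And>lam. \<forall>i\<in>I. norm (lam i) < s \<Longrightarrow>
      ((\<lambda>k. c k * (\<Prod>i\<in>I. lam i ^ Poly_Mapping.lookup k i)) has_sum f lam)
        {k. Poly_Mapping.keys k \<subseteq> I}"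
    unfolding has_power_series_at_0_def by blast
  show ?thesis unfolding has_power_series_at_0_def
  proof (intro exI[of _ "min r s"] conjI allI impI)
    fix lam :: "nat \<Rightarrow> complex" assume lam: "\<forall>i\<in>I. norm (lam i) < min r s"
    show "((\<lambda>k. c' k * (\<Prod>i\<in>I. lam i ^ Poly_Mapping.lookup k i)) has_sum f' lam)
        {k. Poly_Mapping.keys k \<subseteq> I}"
      using s[of lam] assms(3)[of lam] lam assms(4)
      by (subst has_sum_cong[where g = "\<lambda>k. c k * (\<Prod>i\<in>I. lam i ^ Poly_Mapping.lookup k i)"])
        simp_all
  qed (use \<open>s > 0\<close> \<open>r > 0\<close> in auto)
qed

text \<open>The vector of \<open>K_term\<close> over the integers, taken at the whole tuple instead
  of its lowest digits.\<close>

definition L_weight :: "nat \<Rightarrow> (nat \<Rightarrow>\<^sub>0 nat) \<Rightarrow> nat \<Rightarrow> int" where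
  "L_weight g k j = (if j = 1 then 1 else if j = 2 then - 2 * (int (tuple_sum g k) + int g)
     else 2 * int (Poly_Mapping.lookup k j) + 1)"

definition L_coeff_val :: "nat \<Rightarrow> (nat \<Rightarrow>\<^sub>0 nat) \<Rightarrow> nat \<Rightarrow> complex" where
  "L_coeff_val g k j = neg_binom (1 / 2) (tuple_sum g k + g) *
     (\<Prod>i\<in>idx g. neg_binom (1 / 2) (Poly_Mapping.lookup k i)) * of_int (L_weight g k j)"

lemma finite_idx [simp]: "finite (idx g)"
  by (simp add: idx_def)

lemma powr_minus_three_halves:
  assumes "z \<noteq> 0"
  shows "z powr (- (3 / 2)) = z powr (- (1 / 2)) / (z :: complex)"
proof -
  have "- (3 / 2) * Ln z = - (1 / 2) * Ln z - Ln z"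
    by (simp add: algebra_simps)
  thus ?thesis
    using assms by (simp only: powr_def if_False exp_diff exp_Ln[OF assms])
qed

text \<open>Common frame for the three kinds of coordinates: they differ only in the constant
  \<open>z\<close>, the exponents \<open>b\<close> and \<open>a\<close>, and the pole order. The
  prefactor \<open>- 1 / (2 * pi)\<close> and the residue factor \<open>2 * pi * \<i>\<close> leave
  \<open>- \<i> * z\<close>.\<close>

lemma L_fun_power_seriesI:
  assumes "z \<noteq> 0"
    and "\<And>lam x. \<forall>i\<in>idx g. norm (lam i) < 1 / 2 \<Longrightarrow> norm x = 1 / 2 \<Longrightarrow>
      inv_sqrt_branch g lam x * (1 / (x - branch_point lam j)) =
      z * ((1 - x) powr (- b) / x ^ Suc n * (\<Prod>i\<in>idx g. (1 - lam i / x) powr (- a i)))"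
    and "\<And>k. Poly_Mapping.keys k \<subseteq> idx g \<Longrightarrow>
      c k = - \<i> * z * neg_binom b (n + tuple_sum g k) *
        (\<Prod>i\<in>idx g. neg_binom (a i) (Poly_Mapping.lookup k i))"
  shows "has_power_series_at_0 (idx g) (L_fun g j) c"
proof (rule has_power_series_at_0_transfer[OF has_power_series_at_0_cmult[
      where z = "- z / (2 * pi)", OF contour_integral_prod_power_series[of "idx g" b n a]],
      where r = "1 / 2"])
  let ?C = "circlepath 0 (1 / 2)"
  fix lam :: "nat \<Rightarrow> complex" assume lam: "\<forall>i\<in>idx g. norm (lam i) < 1 / 2"
  let ?F = "\<lambda>x. (1 - x) powr (- b) / x ^ Suc n * (\<Prod>i\<in>idx g. (1 - lam i / x) powr (- a i))"
  have "contour_integral ?C (\<lambda>x. inv_sqrt_branch g lam x * (1 / (x - branch_point lam j))) =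
      contour_integral ?C (\<lambda>x. z * ?F x)"
    using assms(2)[OF lam] by (intro contour_integral_cong) auto
  also have "\<dots> = z * contour_integral ?C ?F"
  proof (cases "?F contour_integrable_on ?C")
    \<comment> \<open>A non-integrable function has contour integral 0 by default, and since
      \<open>z\<close> is nonzero both sides take this value; integrability thus need not be
      shown.\<close>
    case False
    thus ?thesis
      using assms(1) contour_integrable_lmul_iff[of z ?F ?C] not_integrable_contour_integral by auto
  qed (rule contour_integral_lmul)
  finally show "L_fun g j lam = - z / (2 * pi) * contour_integral ?C ?F"
    by (simp add: L_fun_def)
qed (use assms(3) in \<open>simp_all add: tuple_sum_def\<close>)

text \<open>For \<open>j = 1\<close> the factor \<open>1 / x\<close> raises the pole order. For
  \<open>j = 2\<close>, \<open>1 / (x - 1)\<close> changes the sign and raises the exponent of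
  \<open>1 - x\<close> to 3/2. For the others, \<open>1 / (x - lam j)\<close> is
  \<open>1 / x\<close> divided by \<open>1 - lam j / x\<close>, which raises both the pole order and
  the exponent of the \<open>j\<close>-th factor.\<close>

lemma L_fun_power_series:
  assumes "1 \<le> g" "j \<in> {1..2 * g + 1}"
  shows "has_power_series_at_0 (idx g) (L_fun g j) (\<lambda>k. L_coeff_val g k j)"
proof -
  consider "j = 1" | "j = 2" | "j \<in> idx g" using assms(2) by (force simp: idx_def)
  thus ?thesis
  proof cases
    case 1
    show ?thesis
      by (rule L_fun_power_seriesI[where z = \<i> and b = "1 / 2" and n = g and a = "\<lambda>_. 1 / 2"])
        (use 1 in \<open>auto simp: L_coeff_val_def L_weight_def inv_sqrt_branch_def branch_point_def
          add.commute mult_ac\<close>)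
  next
    case 2
    \<comment> \<open>No power of \<open>1 / x\<close> is gained here, so the pole has order
      \<open>g = Suc h\<close> and the residue involves the coefficient of index
      \<open>h + tuple_sum g k\<close>, that is \<open>N - 1\<close>.\<close>
    obtain h where g: "g = Suc h" using assms(1) by (cases g) auto
    show ?thesis
    proof (rule L_fun_power_seriesI[where z = "- \<i>" and b = "3 / 2" and n = h and a = "\<lambda>_. 1 / 2"])
      fix lam :: "nat \<Rightarrow> complex" and x :: complex assume "norm x = 1 / 2"
      hence "1 - x \<noteq> 0" by auto
      hence "(1 - x) powr (- (3 / 2)) = - ((1 - x) powr (- (1 / 2)) / (x - 1))"
        by (subst powr_minus_three_halves) (auto simp: field_simps)
      thus "inv_sqrt_branch g lam x * (1 / (x - branch_point lam j)) =
          - \<i> * ((1 - x) powr (- (3 / 2)) / x ^ Suc h *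
            (\<Prod>i\<in>idx g. (1 - lam i / x) powr (- (1 / 2))))"
        using 2 g by (simp add: inv_sqrt_branch_def branch_point_def mult_ac)
    next
      fix k :: "nat \<Rightarrow>\<^sub>0 nat"
      show "L_coeff_val g k j = - \<i> * - \<i> * neg_binom (3 / 2) (h + tuple_sum g k) *
          (\<Prod>i\<in>idx g. neg_binom (1 / 2) (Poly_Mapping.lookup k i))"
        using 2 g by (simp add: L_coeff_val_def L_weight_def neg_binom_half_Suc algebra_simps)
    qed auto
  next
    case 3
    hence j: "j \<noteq> 0" "j \<noteq> 1" "j \<noteq> 2" by (auto simp: idx_def)
    let ?a = "\<lambda>i. if i = j then 3 / 2 else 1 / 2 :: complex"
    show ?thesis
    proof (rule L_fun_power_seriesI[where z = \<i> and b = "1 / 2" and n = g and a = ?a])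
      fix lam :: "nat \<Rightarrow> complex" and x :: complex
      assume "\<forall>i\<in>idx g. norm (lam i) < 1 / 2" and x: "norm x = 1 / 2"
      hence "norm (lam j) < norm x" using 3 by (simp only:)
      hence nz: "x \<noteq> 0" "x \<noteq> lam j" by auto
      hence "1 - lam j / x \<noteq> 0" by (simp add: field_simps)
      hence "(1 - lam j / x) powr (- (3 / 2)) = (1 - lam j / x) powr (- (1 / 2)) / (1 - lam j / x)"
        by (rule powr_minus_three_halves)
      also have "\<dots> = (1 - lam j / x) powr (- (1 / 2)) * (x / (x - lam j))"
        using nz by (simp add: field_simps)
      finally have pj: "(1 - lam j / x) powr (- (3 / 2)) =
          (1 - lam j / x) powr (- (1 / 2)) * (x / (x - lam j))" .
      have "(\<Prod>i\<in>idx g. (1 - lam i / x) powr (- ?a i)) = (1 - lam j / x) powr (- (3 / 2)) *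
          (\<Prod>i\<in>idx g - {j}. (1 - lam i / x) powr (- (1 / 2)))"
        using 3 by (subst prod.remove[OF finite_idx 3]) (auto intro!: prod.cong)
      also have "\<dots> = (x / (x - lam j)) * (\<Prod>i\<in>idx g. (1 - lam i / x) powr (- (1 / 2)))"
        by (subst prod.remove[OF finite_idx 3]) (simp add: pj)
      finally have P: "(\<Prod>i\<in>idx g. (1 - lam i / x) powr (- ?a i)) =
          (x / (x - lam j)) * (\<Prod>i\<in>idx g. (1 - lam i / x) powr (- (1 / 2)))" .
      show "inv_sqrt_branch g lam x * (1 / (x - branch_point lam j)) =
          \<i> * ((1 - x) powr (- (1 / 2)) / x ^ Suc g * (\<Prod>i\<in>idx g. (1 - lam i / x) powr (- ?a i)))"
        unfolding P using j nz by (simp add: inv_sqrt_branch_def branch_point_def)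
    next
      fix k :: "nat \<Rightarrow>\<^sub>0 nat"
      have "(\<Prod>i\<in>idx g. neg_binom (?a i) (Poly_Mapping.lookup k i)) =
          neg_binom (3 / 2) (Poly_Mapping.lookup k j) *
          (\<Prod>i\<in>idx g - {j}. neg_binom (1 / 2) (Poly_Mapping.lookup k i))"
        using 3 by (subst prod.remove[OF finite_idx 3]) (auto intro!: prod.cong)
      also have "\<dots> = (2 * of_nat (Poly_Mapping.lookup k j) + 1) *
          (\<Prod>i\<in>idx g. neg_binom (1 / 2) (Poly_Mapping.lookup k i))"
        by (subst prod.remove[OF finite_idx 3]) (simp add: neg_binom_three_halves)
      finally show "L_coeff_val g k j = - \<i> * \<i> * neg_binom (1 / 2) (g + tuple_sum g k) *
          (\<Prod>i\<in>idx g. neg_binom (?a i) (Poly_Mapping.lookup k i))"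
        using j by (simp add: L_coeff_val_def L_weight_def add.commute)
    qed simp
  qed
qed

lemma L_coeff_eq:
  assumes "1 \<le> g" "j \<in> {1..2 * g + 1}" "Poly_Mapping.keys k \<subseteq> idx g"
  shows "L_coeff g k j = L_coeff_val g k j"
proof -
  note ps = L_fun_power_series[OF assms(1,2)]
  show ?thesis
    unfolding L_coeff_def
  proof (rule the_equality)
    fix z assume "\<exists>c. has_power_series_at_0 (idx g) (L_fun g j) c \<and> z = c k"
    thus "z = L_coeff_val g k j"
      using has_power_series_at_0_unique[OF finite_idx _ ps assms(3)] by blast
  qed (use ps in blast)
qed

subsection \<open>Central binomial coefficients modulo \<open>p\<close>\<close>

text \<open>Coefficients of \<open>(1 + z) ^ (n + p) = (1 + z) ^ n * (1 + z ^ p)\<close> in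
  characteristic \<open>p\<close>. The case \<open>n = 0\<close> is the divisibility of the inner
  binomials by \<open>p\<close>; Pascal's rule does the rest.\<close>

lemma of_nat_choose_add_prime:
  "(of_nat ((n + CARD('p)) choose m) :: 'p::prime_card mod_ring) =
     of_nat (n choose m) + (if CARD('p) \<le> m then of_nat (n choose (m - CARD('p))) else 0)"
proof (induction n arbitrary: m)
  case 0
  consider "m = 0" | "0 < m" "m < CARD('p)" | "m = CARD('p)" | "CARD('p) < m" by linarith
  thus ?case
  proof cases
    case 2
    hence "CARD('p) dvd CARD('p) choose m"
      using prime_card[where 'a = 'p] by (intro dvd_choose_prime) auto
    then obtain q where "CARD('p) choose m = CARD('p) * q" by blast
    hence "(of_nat (CARD('p) choose m) :: 'p mod_ring) = 0" by simp
    thus ?thesis using 2 by (simp add: binomial_eq_0)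
  qed (auto simp: binomial_eq_0)
next
  case (Suc n)
  show ?case
  proof (cases m)
    case (Suc m')
    have "(of_nat ((Suc n + CARD('p)) choose m) :: 'p mod_ring) =
        of_nat ((n + CARD('p)) choose m') + of_nat ((n + CARD('p)) choose Suc m')"
      using Suc by simp
    also have "\<dots> = of_nat (n choose m') + (if CARD('p) \<le> m' then of_nat (n choose (m' - CARD('p))) else 0)
        + (of_nat (n choose Suc m') +
           (if CARD('p) \<le> Suc m' then of_nat (n choose (Suc m' - CARD('p))) else 0))"
      by (simp only: Suc.IH)
    also have "\<dots> = of_nat (Suc n choose m) +
        (if CARD('p) \<le> m then of_nat (Suc n choose (m - CARD('p))) else 0)"
    proof -
      \<comment> \<open>In the boundary case \<open>CARD('p) = Suc m'\<close> only the second
        summand has a shifted term, and it equals 1 on both sides.\<close>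
      consider "CARD('p) \<le> m'" | "CARD('p) = Suc m'" | "Suc m' < CARD('p)" by linarith
      thus ?thesis by cases (use Suc in \<open>simp_all add: Suc_diff_le\<close>)
    qed
    finally show ?thesis .
  qed simp
qed

text \<open>One digit of Lucas' theorem: raising \<open>b\<close> by 1 adds \<open>p\<close> to the
  upper entry, which acts as Pascal's rule on \<open>b choose d\<close>.\<close>

lemma lucas_mod_ring:
  assumes "a < CARD('p)" "c < CARD('p)"
  shows "(of_nat ((a + CARD('p) * b) choose (c + CARD('p) * d)) :: 'p::prime_card mod_ring) =
     of_nat (a choose c) * of_nat (b choose d)"
proof (induction b arbitrary: d)
  case 0
  show ?case using assms by (cases d) (simp_all add: binomial_eq_0)
next
  case (Suc b)
  have "a + CARD('p) * Suc b = a + CARD('p) * b + CARD('p)" by simp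
  hence "(of_nat ((a + CARD('p) * Suc b) choose (c + CARD('p) * d)) :: 'p mod_ring) =
      of_nat ((a + CARD('p) * b) choose (c + CARD('p) * d)) +
      (if CARD('p) \<le> c + CARD('p) * d
       then of_nat ((a + CARD('p) * b) choose (c + CARD('p) * d - CARD('p))) else 0)"
    by (simp only: of_nat_choose_add_prime)
  also have "\<dots> = of_nat (a choose c) * of_nat (Suc b choose d)"
  proof (cases d)
    case 0
    thus ?thesis using Suc.IH[of 0] assms by simp
  next
    case (Suc e)
    have "c + CARD('p) * d - CARD('p) = c + CARD('p) * e" using Suc by simp
    thus ?thesis using Suc by (simp only: Suc.IH) (simp add: algebra_simps)
  qed
  finally show ?case .
qed

lemma two_neq_0_mod_ring:
  assumes "2 < CARD('p)"
  shows "(2 :: 'p::prime_card mod_ring) \<noteq> 0"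
proof
  assume "(2 :: 'p mod_ring) = 0"
  hence "(of_nat 2 :: 'p mod_ring) = 0" by simp
  from of_nat_0_mod_ring_dvd[OF this] show False using assms by (auto dest: dvd_imp_le)
qed

lemma four_neq_0_mod_ring:
  assumes "2 < CARD('p)"
  shows "(4 :: 'p::prime_card mod_ring) \<noteq> 0"
proof -
  have "(4 :: 'p mod_ring) = 2 * 2" by simp
  thus ?thesis using two_neq_0_mod_ring[OF assms] by (simp only: mult_eq_0_iff) simp
qed

text \<open>The reduction of the coefficient of \<open>z ^ n\<close> in \<open>(1 - z) powr (- 1 / 2)\<close>.\<close>

definition central :: "nat \<Rightarrow> 'p::prime_card mod_ring" where
  "central n = of_nat ((2 * n) choose n) / 4 ^ n"

text \<open>Fermat's little theorem; it lets the powers of 4 in \<open>central\<close> split along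
  base \<open>p\<close> digits.\<close>

lemma power_CARD_mod_ring: "(x :: 'p::prime_card mod_ring) ^ CARD('p) = x"
proof -
  obtain i where x: "x = of_nat i" using surj_of_nat_mod_ring by blast
  show ?thesis
  proof (cases "CARD('p) dvd i")
    case True
    then obtain q where "i = CARD('p) * q" by blast
    thus ?thesis using x by (simp add: zero_power)
  next
    case False
    hence "[i ^ (CARD('p) - 1) = 1] (mod CARD('p))"
      using fermat_theorem[OF prime_card] by blast
    hence "(of_nat (i ^ (CARD('p) - 1)) :: 'p mod_ring) = of_nat 1"
      by (simp only: of_nat_eq_iff_cong_CHAR semiring_char_mod_ring)
    hence "x ^ (CARD('p) - 1) = 1" by (simp add: x)
    thus ?thesis using power_minus_mult[of "CARD('p)" x] by simp
  qed
qed

text \<open>If \<open>2 * n < p\<close>, doubling produces no carry and Lucas applies directly.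
  Otherwise a carry occurs, and both sides vanish.\<close>

lemma central_add_mult:
  assumes "n < CARD('p)"
  shows "(central (n + CARD('p) * m) :: 'p::prime_card mod_ring) = central n * central m"
proof -
  have "(of_nat ((2 * (n + CARD('p) * m)) choose (n + CARD('p) * m)) :: 'p mod_ring) =
      of_nat ((2 * n) choose n) * of_nat ((2 * m) choose m)"
  proof (cases "2 * n < CARD('p)")
    case True
    have "2 * (n + CARD('p) * m) = 2 * n + CARD('p) * (2 * m)" by simp
    thus ?thesis using lucas_mod_ring[OF True assms] by (simp only:)
  next
    case False
    \<comment> \<open>The lowest digit of \<open>2 * n\<close> after the carry is \<open>q\<close>;
      it is smaller than \<open>n\<close>, so \<open>q choose n = 0\<close>.\<close>
    define q where "q = 2 * n - CARD('p)"
    have q: "2 * n = q + CARD('p) * 1" "q < n" "q < CARD('p)"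
      using False assms by (auto simp: q_def)
    have "2 * (n + CARD('p) * m) = q + CARD('p) * (2 * m + 1)" using q(1) by simp
    hence "(of_nat ((2 * (n + CARD('p) * m)) choose (n + CARD('p) * m)) :: 'p mod_ring) =
        of_nat (q choose n) * of_nat ((2 * m + 1) choose m)"
      using lucas_mod_ring[OF q(3) assms] by (simp only:)
    moreover have "(of_nat ((2 * n) choose n) :: 'p mod_ring) = of_nat (q choose n)"
      using lucas_mod_ring[OF q(3) assms, of 1 0] q(1) by simp
    ultimately show ?thesis using q(2) by (simp add: binomial_eq_0)
  qed
  moreover have "(4 :: 'p mod_ring) ^ (n + CARD('p) * m) = 4 ^ n * 4 ^ m"
    by (simp only: power_add power_mult power_CARD_mod_ring)
  ultimately show ?thesis
    by (simp only: central_def times_divide_times_eq)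
qed

text \<open>The ratio of consecutive central binomials, cleared of denominators so that it can be
  read modulo \<open>p\<close>.\<close>

lemma Suc_times_central_binomial:
  "Suc n * ((2 * Suc n) choose Suc n) = 2 * (2 * n + 1) * ((2 * n) choose n)"
proof -
  have "Suc n * ((2 * Suc n) choose Suc n) = 2 * (Suc n * ((2 * n + 1) choose n))"
    using Suc_times_binomial[of n "2 * n + 1"] by simp
  also have "Suc n * ((2 * n + 1) choose n) = (2 * n + 1) * ((2 * n) choose n)"
    using binomial_absorb_comp[of "2 * n + 1" n] by simp
  finally show ?thesis by simp
qed

text \<open>Both sides obey \<open>2 * (n + 1) * u (n + 1) = (2 * n + 1) * u n\<close> and start at
  1; the factor \<open>2 * (n + 1)\<close> is invertible as long as
  \<open>n + 1 < p\<close>.\<close>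

lemma central_eq_choose:
  assumes "2 < CARD('p)" "n < CARD('p)"
  shows "(central n :: 'p::prime_card mod_ring) = (- 1) ^ n * of_nat (((CARD('p) - 1) div 2) choose n)"
  using assms(2)
proof (induction n)
  case 0
  show ?case by (simp add: central_def)
next
  case (Suc n)
  let ?h = "(CARD('p) - 1) div 2"
  note nz = two_neq_0_mod_ring[OF assms(1)] four_neq_0_mod_ring[OF assms(1)]
  have "odd (CARD('p))"
    using prime_card[where 'a = 'p] assms(1) prime_odd_nat by blast
  hence "2 * ?h + 1 = CARD('p)" using assms(1) by (auto elim!: oddE)
  \<comment> \<open>Modulo \<open>p\<close> the number \<open>(p - 1) div 2\<close> is -1/2, the
    exponent of the binomial series.\<close>
  hence h: "2 * (of_nat ?h :: 'p mod_ring) + 1 = 0"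
    by (metis of_nat_card_eq_0 of_nat_add of_nat_mult of_nat_numeral of_nat_1)
  have Suc_nz: "(of_nat (Suc n) :: 'p mod_ring) \<noteq> 0"
    using of_nat_0_mod_ring_dvd[of "Suc n", where 'a = 'p] Suc.prems nat_dvd_not_less by blast
  have "of_nat (Suc n) * of_nat ((2 * Suc n) choose Suc n) =
      2 * (2 * of_nat n + 1) * (of_nat ((2 * n) choose n) :: 'p mod_ring)"
    using arg_cong[OF Suc_times_central_binomial[of n], of "of_nat :: nat \<Rightarrow> 'p mod_ring"]
    by (simp only: of_nat_mult of_nat_add of_nat_numeral of_nat_1)
  moreover have "2 * s * (x / 4 ^ Suc n) = c * (y / 4 ^ n)" if "s * x = 2 * c * y"
    for s x y c :: "'p mod_ring"
  proof -
    have "2 * s * (x / 4 ^ Suc n) = 2 * (s * x) / 4 ^ Suc n" by simp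
    also have "\<dots> = 4 * (c * y) / (4 * 4 ^ n)" by (simp add: that)
    also have "\<dots> = c * (y / 4 ^ n)"
      by (subst mult_divide_mult_cancel_left[OF nz(2)]) simp
    finally show ?thesis .
  qed
  ultimately have "2 * of_nat (Suc n) * (central (Suc n) :: 'p mod_ring) =
      (2 * of_nat n + 1) * central n"
    unfolding central_def by blast
  also have "\<dots> = (2 * of_nat n + 1) * ((- 1) ^ n * of_nat (?h choose n))"
    using Suc by simp
  also have "\<dots> = 2 * of_nat (Suc n) * ((- 1) ^ Suc n * of_nat (?h choose Suc n))"
  proof (cases "n \<le> ?h")
    case True
    have "Suc n * (?h choose Suc n) = (?h - n) * (?h choose n)"
      by (metis binomial_absorb_comp binomial_absorption)
    from arg_cong[OF this, of "of_nat :: nat \<Rightarrow> 'p mod_ring"] True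
    have eq: "of_nat (Suc n) * of_nat (?h choose Suc n) =
        (of_nat ?h - of_nat n) * (of_nat (?h choose n) :: 'p mod_ring)"
      by (simp only: of_nat_mult of_nat_diff)
    have "2 * of_nat (Suc n) * ((- 1) ^ Suc n * of_nat (?h choose Suc n)) =
        2 * ((- 1) ^ Suc n * ((of_nat ?h - of_nat n) * (of_nat (?h choose n) :: 'p mod_ring)))"
      unfolding eq[symmetric] by (simp only: mult_ac)
    \<comment> \<open>Writing \<open>2 * n - 2 * h\<close> as
      \<open>(2 * n + 1) - (2 * h + 1)\<close> isolates a multiple of \<open>2 * h + 1\<close>,
      which is 0.\<close>
    also have "\<dots> = (2 * of_nat n + 1) * ((- 1) ^ n * of_nat (?h choose n))
        - (2 * of_nat ?h + 1) * ((- 1) ^ n * of_nat (?h choose n))"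
      by (simp add: algebra_simps)
    finally show ?thesis by (simp only: h) simp
  qed (simp add: binomial_eq_0)
  finally have eq: "2 * of_nat (Suc n) * (central (Suc n) :: 'p mod_ring) =
      2 * of_nat (Suc n) * ((- 1) ^ Suc n * of_nat (?h choose Suc n))" .
  have "2 * of_nat (Suc n) \<noteq> (0 :: 'p mod_ring)"
    using nz(1) Suc_nz by (simp only: mult_eq_0_iff) simp
  from mult_left_cancel[THEN iffD1, OF this eq] show ?case .
qed

text \<open>For \<open>n\<close> up to \<open>h = (p - 1) div 2\<close> the binomial divides
  \<open>fact h\<close>, which is prime to \<open>p\<close>; beyond \<open>h\<close> it is
  0.\<close>

lemma central_neq_0_iff:
  assumes "2 < CARD('p)" "n < CARD('p)"
  shows "(central n :: 'p::prime_card mod_ring) \<noteq> 0 \<longleftrightarrow> n \<le> (CARD('p) - 1) div 2"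
proof
  let ?h = "(CARD('p) - 1) div 2"
  assume n: "n \<le> ?h"
  have "\<not> CARD('p) dvd ?h choose n"
  proof
    assume "CARD('p) dvd ?h choose n"
    hence "CARD('p) dvd fact n * fact (?h - n) * (?h choose n)" by simp
    hence "CARD('p) dvd fact ?h" using binomial_fact_lemma[OF n] by simp
    hence "CARD('p) \<le> ?h" using prime_card[where 'a = 'p] prime_dvd_fact_iff by blast
    thus False using assms(1) by simp
  qed
  hence "(of_nat (?h choose n) :: 'p mod_ring) \<noteq> 0"
    using of_nat_0_mod_ring_dvd by blast
  thus "(central n :: 'p mod_ring) \<noteq> 0" by (simp add: central_eq_choose[OF assms])
next
  assume "(central n :: 'p mod_ring) \<noteq> 0"
  thus "n \<le> (CARD('p) - 1) div 2"
    by (rule contrapos_np) (simp add: central_eq_choose[OF assms] binomial_eq_0)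
qed

subsection \<open>Digits and carries\<close>

text \<open>Integer numerator of the Taylor coefficient over a power of 2, the shape that
  \<open>Z_half\<close> and \<open>reduce\<close> ask for.\<close>

definition L_num :: "nat \<Rightarrow> (nat \<Rightarrow>\<^sub>0 nat) \<Rightarrow> nat \<Rightarrow> int" where
  "L_num g k j = int ((2 * (tuple_sum g k + g)) choose (tuple_sum g k + g)) *
     (\<Prod>i\<in>idx g. int ((2 * Poly_Mapping.lookup k i) choose Poly_Mapping.lookup k i)) * L_weight g k j"

text \<open>Stated over any field, since the complex instance gives the coefficient and the instance
  modulo \<open>p\<close> its reduction.\<close>

lemma L_num_over_field:
  "(of_int (L_num g k j) :: 'a::field) / 2 ^ (2 * (tuple_sum g k + g + tuple_sum g k)) =
     of_nat ((2 * (tuple_sum g k + g)) choose (tuple_sum g k + g)) / 4 ^ (tuple_sum g k + g) *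
     (\<Prod>i\<in>idx g. of_nat ((2 * Poly_Mapping.lookup k i) choose Poly_Mapping.lookup k i) /
        4 ^ Poly_Mapping.lookup k i) * of_int (L_weight g k j)"
proof -
  have "(2 :: 'a) ^ (2 * (m + n)) = 4 ^ m * 4 ^ n" for m n
    by (simp add: power_mult power_add)
  moreover have "(4 :: 'a) ^ tuple_sum g k = (\<Prod>i\<in>idx g. 4 ^ Poly_Mapping.lookup k i)"
    by (simp add: tuple_sum_def power_sum)
  ultimately have "(2 :: 'a) ^ (2 * (tuple_sum g k + g + tuple_sum g k)) =
      4 ^ (tuple_sum g k + g) * (\<Prod>i\<in>idx g. 4 ^ Poly_Mapping.lookup k i)"
    by (simp only:)
  thus ?thesis by (simp add: L_num_def prod_dividef)
qed

text \<open>Well-definedness of \<open>reduce\<close>: equal fractions are cross-multiplied to an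
  integer identity, which is reduced and divided by powers of 2, invertible for
  \<open>p > 2\<close>.\<close>

lemma reduce_of_int_divide:
  assumes "2 < CARD('p)"
  shows "(reduce (of_int n / 2 ^ e) :: 'p::prime_card mod_ring) = of_int n / 2 ^ e"
  unfolding reduce_def
proof (rule the_equality)
  fix r :: "'p mod_ring"
  assume "\<exists>n' e'. (of_int n :: complex) / 2 ^ e = of_int n' / 2 ^ e' \<and> r = of_int n' / 2 ^ e'"
  then obtain n' e' where eq: "(of_int n :: complex) / 2 ^ e = of_int n' / 2 ^ e'"
    and r: "r = of_int n' / 2 ^ e'" by blast
  from eq have "(of_int (n * 2 ^ e') :: complex) = of_int (n' * 2 ^ e)"
    by (simp add: field_simps)
  hence "n * 2 ^ e' = n' * 2 ^ e" by (simp only: of_int_eq_iff)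
  hence "(of_int (n * 2 ^ e') :: 'p mod_ring) = of_int (n' * 2 ^ e)" by (simp only:)
  thus "r = of_int n / 2 ^ e"
    using two_neq_0_mod_ring[OF assms] by (simp add: r field_simps)
qed blast

lemma L_coeff_val_eq:
  "L_coeff_val g k j = of_int (L_num g k j) / 2 ^ (2 * (tuple_sum g k + g + tuple_sum g k))"
  by (simp only: L_num_over_field L_coeff_val_def neg_binom_half)

lemma reduce_L_coeff_val:
  assumes "2 < CARD('p)"
  shows "(reduce (L_coeff_val g k j) :: 'p::prime_card mod_ring) =
     central (tuple_sum g k + g) * (\<Prod>i\<in>idx g. central (Poly_Mapping.lookup k i)) *
     of_int (L_weight g k j)"
  by (simp only: L_coeff_val_eq reduce_of_int_divide[OF assms]) (simp only: L_num_over_field central_def)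

section \<open>Base \<open>p\<close> digits and the top index\<close>

lemma lookup_digit_tuple [simp]:
  "Poly_Mapping.lookup (digit_tuple p k j) i = digit p (Poly_Mapping.lookup k i) j"
  by (simp add: digit_tuple_def map.rep_eq when_def digit_def)

lemma keys_digit_tuple: "Poly_Mapping.keys (digit_tuple p k j) \<subseteq> Poly_Mapping.keys k"
proof
  fix i assume "i \<in> Poly_Mapping.keys (digit_tuple p k j)"
  thus "i \<in> Poly_Mapping.keys k"
    by (cases "Poly_Mapping.lookup k i = 0") (auto simp: in_keys_iff digit_def)
qed

lemma div_eq_digit_plus: "n div p ^ t = digit p n t + p * (n div p ^ Suc t)" for n p t :: nat
proof -
  have "n div p ^ Suc t = n div p ^ t div p"
    by (simp only: power_Suc2 div_mult2_eq)
  thus ?thesis by (simp only: digit_def mod_mult_div_eq)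
qed

lemma sum_digits: "(\<Sum>j<t. digit p n j * p ^ j) + (n div p ^ t) * p ^ t = n" for n p t :: nat
proof (induction t)
  case (Suc t)
  have "digit p n t * p ^ t + (n div p ^ Suc t) * p ^ Suc t = (n div p ^ t) * p ^ t"
    unfolding div_eq_digit_plus[of n p t] by (simp add: algebra_simps)
  thus ?case using Suc by simp
qed simp

text \<open>The \<open>THE\<close> in \<open>top_index\<close> is met exactly by the least
  \<open>a\<close> such that all entries lie below \<open>p ^ Suc a\<close>.\<close>

lemma lookup_eq_sum_digits:
  assumes "1 < p"
  shows "i \<in> idx g \<Longrightarrow> Poly_Mapping.lookup k i =
      (\<Sum>j\<le>top_index p g k. digit p (Poly_Mapping.lookup k i) j * p ^ j)"
proof -
  let ?k = "Poly_Mapping.lookup k"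
  let ?Q = "\<lambda>a. (\<forall>i\<in>idx g. ?k i = (\<Sum>j\<le>a. digit p (?k i) j * p ^ j)) \<and>
             (if \<forall>i\<in>idx g. ?k i = 0 then a = 0 else \<exists>i\<in>idx g. digit p (?k i) a \<noteq> 0)"
  have sum_eq_iff: "n = (\<Sum>j\<le>a. digit p n j * p ^ j) \<longleftrightarrow> n < p ^ Suc a" for n a
  proof -
    have "n = (\<Sum>j\<le>a. digit p n j * p ^ j) \<longleftrightarrow> (n div p ^ Suc a) * p ^ Suc a = 0"
      using sum_digits[of p n "Suc a"] unfolding lessThan_Suc_atMost by linarith
    also have "\<dots> \<longleftrightarrow> n < p ^ Suc a"
      using assms by (auto simp: div_eq_0_iff)
    finally show ?thesis .
  qed
  define a where "a = (LEAST a. \<forall>i\<in>idx g. ?k i < p ^ Suc a)"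
  have "\<exists>a. \<forall>i\<in>idx g. ?k i < p ^ Suc a"
  proof (intro exI ballI)
    fix i assume "i \<in> idx g"
    hence "?k i \<le> tuple_sum g k" unfolding tuple_sum_def by (intro member_le_sum) auto
    also have "\<dots> < p ^ tuple_sum g k" using assms by (intro power_gt_expt) simp
    also have "\<dots> \<le> p ^ Suc (tuple_sum g k)" using assms by (intro power_increasing) auto
    finally show "?k i < p ^ Suc (tuple_sum g k)" .
  qed
  hence a: "\<forall>i\<in>idx g. ?k i < p ^ Suc a"
    unfolding a_def by (rule LeastI_ex)
  have least: "a \<le> b" if "\<forall>i\<in>idx g. ?k i < p ^ Suc b" for b
    unfolding a_def using that by (rule Least_le)
  have "?Q a"
  proof (cases "\<forall>i\<in>idx g. ?k i = 0")
    case True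
    hence "a = 0" using least[of 0] assms by simp
    thus ?thesis using True a sum_eq_iff by (auto simp: digit_def)
  next
    case False
    have "\<exists>i\<in>idx g. digit p (?k i) a \<noteq> 0"
    proof (cases a)
      case 0
      thus ?thesis using False a by (auto simp: digit_def)
    next
      case (Suc b)
      hence "\<not> (\<forall>i\<in>idx g. ?k i < p ^ Suc b)" using least[of b] by linarith
      then obtain i where i: "i \<in> idx g" "p ^ a \<le> ?k i" using Suc by force
      have "?k i div p ^ a = digit p (?k i) a"
        using div_eq_digit_plus[of "?k i" p a] a i(1) by simp
      moreover have "?k i div p ^ a \<noteq> 0"
        using i(2) assms by (simp add: div_eq_0_iff)
      ultimately show ?thesis using i(1) by auto
    qed
    thus ?thesis using False a sum_eq_iff by auto
  qed
  moreover have "b = a" if "?Q b" for b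
  proof (cases "\<forall>i\<in>idx g. ?k i = 0")
    case True
    thus ?thesis using that \<open>?Q a\<close> by simp
  next
    case False
    \<comment> \<open>All digits beyond position \<open>a\<close> vanish, against the nonzero digit
      required at \<open>b\<close>; the reverse inequality is minimality of
      \<open>a\<close>.\<close>
    have "\<not> a < b"
    proof
      assume "a < b"
      have "digit p (?k i) b = 0" if "i \<in> idx g" for i
      proof -
        have "?k i < p ^ Suc a" using a that by blast
        also have "\<dots> \<le> p ^ b" using \<open>a < b\<close> assms by (intro power_increasing) auto
        finally show ?thesis by (simp add: digit_def)
      qed
      thus False using \<open>?Q b\<close> False by auto
    qed
    moreover have "a \<le> b"
      using that by (intro least) (use sum_eq_iff in blast)
    ultimately show ?thesis by simp
  qed
  ultimately have "top_index p g k = a"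
    unfolding top_index_def by (rule the_equality)
  thus "i \<in> idx g \<Longrightarrow> ?k i = (\<Sum>j\<le>top_index p g k. digit p (?k i) j * p ^ j)"
    using \<open>?Q a\<close> by blast
qed

lemma div_top_index_eq_0:
  assumes "1 < p" "i \<in> idx g"
  shows "Poly_Mapping.lookup k i div p ^ Suc (top_index p g k) = 0"
proof -
  let ?n = "Poly_Mapping.lookup k i" and ?a = "top_index p g k"
  have "(?n div p ^ Suc ?a) * p ^ Suc ?a = 0"
    using sum_digits[of p ?n "Suc ?a"] lookup_eq_sum_digits[OF assms, of k]
    unfolding lessThan_Suc_atMost by linarith
  thus ?thesis using assms(1) by simp
qed

text \<open>Agrees with \<^const>\<open>shift_coeff\<close> where the latter is meaningful, but is defined for all tuples.\<close>

primrec carry :: "nat \<Rightarrow> nat \<Rightarrow> (nat \<Rightarrow>\<^sub>0 nat) \<Rightarrow> nat \<Rightarrow> nat" where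
  "carry p g k 0 = g"
| "carry p g k (Suc t) = (tuple_sum g (digit_tuple p k t) + carry p g k t) div p"

definition sum_digit :: "nat \<Rightarrow> nat \<Rightarrow> (nat \<Rightarrow>\<^sub>0 nat) \<Rightarrow> nat \<Rightarrow> nat" where
  "sum_digit p g k t = (tuple_sum g (digit_tuple p k t) + carry p g k t) mod p"

lemma sum_digit_plus_carry:
  "sum_digit p g k t + carry p g k (Suc t) * p = tuple_sum g (digit_tuple p k t) + carry p g k t"
  by (simp add: sum_digit_def)

text \<open>What remains after the \<open>t\<close> lowest digits are removed from \<open>N\<close>
  and from every entry; the argument of the first factor is \<open>N div p ^ t\<close>.\<close>

definition truncated_central :: "nat \<Rightarrow> (nat \<Rightarrow>\<^sub>0 nat) \<Rightarrow> nat \<Rightarrow> 'p::prime_card mod_ring" where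
  "truncated_central g k t =
     central ((\<Sum>i\<in>idx g. Poly_Mapping.lookup k i div CARD('p) ^ t) + carry CARD('p) g k t) *
     (\<Prod>i\<in>idx g. central (Poly_Mapping.lookup k i div CARD('p) ^ t))"

definition digit_central :: "nat \<Rightarrow> (nat \<Rightarrow>\<^sub>0 nat) \<Rightarrow> nat \<Rightarrow> 'p::prime_card mod_ring" where
  "digit_central g k t = central (sum_digit CARD('p) g k t) *
     (\<Prod>i\<in>idx g. central (digit CARD('p) (Poly_Mapping.lookup k i) t))"

lemma digit_less_CARD: "digit CARD('p::prime_card) n t < CARD('p)"
  by (simp add: digit_def)

lemma sum_digit_less_CARD: "sum_digit CARD('p::prime_card) g k t < CARD('p)"
  by (simp add: sum_digit_def)

text \<open>Column \<open>t\<close> of the addition: its sum is the digit of \<open>N\<close> plus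
  \<open>p\<close> times the carry, and the carry joins the next column. Then
  \<open>central_add_mult\<close> splits every factor.\<close>

lemma truncated_central_step:
  "(truncated_central g k t :: 'p::prime_card mod_ring) =
     digit_central g k t * truncated_central g k (Suc t)"
proof -
  let ?p = "CARD('p)"
  let ?k = "Poly_Mapping.lookup k"
  have "(\<Sum>i\<in>idx g. ?k i div ?p ^ t) =
      tuple_sum g (digit_tuple ?p k t) + ?p * (\<Sum>i\<in>idx g. ?k i div ?p ^ Suc t)"
    unfolding div_eq_digit_plus[of _ ?p t] tuple_sum_def lookup_digit_tuple
    by (simp only: sum.distrib sum_distrib_left)
  hence "(\<Sum>i\<in>idx g. ?k i div ?p ^ t) + carry ?p g k t =
      sum_digit ?p g k t + ?p * ((\<Sum>i\<in>idx g. ?k i div ?p ^ Suc t) + carry ?p g k (Suc t))"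
    using sum_digit_plus_carry[of ?p g k t] by (simp add: algebra_simps)
  hence "(central ((\<Sum>i\<in>idx g. ?k i div ?p ^ t) + carry ?p g k t) :: 'p mod_ring) =
      central (sum_digit ?p g k t) *
      central ((\<Sum>i\<in>idx g. ?k i div ?p ^ Suc t) + carry ?p g k (Suc t))"
    by (simp only: central_add_mult[OF sum_digit_less_CARD])
  moreover have "(central (?k i div ?p ^ t) :: 'p mod_ring) =
      central (digit ?p (?k i) t) * central (?k i div ?p ^ Suc t)" for i
    unfolding div_eq_digit_plus[of _ ?p t] by (rule central_add_mult[OF digit_less_CARD])
  ultimately show ?thesis
    by (simp only: truncated_central_def digit_central_def prod.distrib mult_ac)
qed

lemma truncated_central_0_eq_prod:
  "(truncated_central g k 0 :: 'p::prime_card mod_ring) =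
     (\<Prod>t<n. digit_central g k t) * truncated_central g k n"
proof (induction n)
  case (Suc n)
  thus ?case by (simp add: truncated_central_step[of g k n] mult.assoc)
qed simp

text \<open>Past the top index the entries are used up, and only the last carry, the top digit of
  \<open>N\<close>, is left.\<close>

lemma central_product_eq:
  "(central (tuple_sum g k + g) * (\<Prod>i\<in>idx g. central (Poly_Mapping.lookup k i)) :: 'p::prime_card mod_ring) =
     (\<Prod>t\<le>top_index CARD('p) g k. digit_central g k t) *
     central (carry CARD('p) g k (Suc (top_index CARD('p) g k)))"
proof -
  have "1 < CARD('p)" using prime_card[where 'a = 'p] prime_gt_1_nat by blast
  hence "(truncated_central g k (Suc (top_index CARD('p) g k)) :: 'p mod_ring) =
      central (carry CARD('p) g k (Suc (top_index CARD('p) g k)))"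
    by (simp add: truncated_central_def div_top_index_eq_0 central_def del: carry.simps power_Suc)
  moreover have "(truncated_central g k 0 :: 'p mod_ring) =
      central (tuple_sum g k + g) * (\<Prod>i\<in>idx g. central (Poly_Mapping.lookup k i))"
    by (simp add: truncated_central_def tuple_sum_def)
  ultimately show ?thesis
    using truncated_central_0_eq_prod[of g k "Suc (top_index CARD('p) g k)", where 'p = 'p]
    by (simp only: lessThan_Suc_atMost)
qed

text \<open>There are \<open>2 * g - 1\<close> digits, each at most
  \<open>h = (p - 1) div 2\<close>, and a carry at most \<open>g\<close>; their sum is below
  \<open>g * p\<close>.\<close>

lemma carry_Suc_less:
  assumes "1 \<le> g" "2 * g + 1 \<le> p" "odd p" "small_digits p g k" "t \<le> top_index p g k" "carry p g k t \<le> g"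
  shows "carry p g k (Suc t) < g"
proof -
  define h where "h = (p - 1) div 2"
  have p: "p = 2 * h + 1" using assms(3) by (auto simp: h_def elim!: oddE)
  have "tuple_sum g (digit_tuple p k t) \<le> (\<Sum>i\<in>idx g. h)"
    unfolding tuple_sum_def lookup_digit_tuple h_def
    using assms(4,5) by (intro sum_mono) (auto simp: small_digits_def)
  also have "\<dots> = (2 * g - 1) * h" by (simp add: idx_def)
  finally have "tuple_sum g (digit_tuple p k t) + carry p g k t \<le> (2 * g - 1) * h + g"
    using assms(6) by simp
  \<comment> \<open>With \<open>p = 2 * h + 1\<close> the right side exceeds the left by exactly
    \<open>h\<close>, which is positive.\<close>
  also have "(2 * g - 1) * h + g < g * p"
  proof -
    obtain f where "g = Suc f" using assms(1) by (cases g) auto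
    thus ?thesis using assms(2) p by (simp add: algebra_simps)
  qed
  finally show ?thesis by (simp add: less_mult_imp_div_less)
qed

lemma carry_le:
  assumes "1 \<le> g" "2 * g + 1 \<le> p" "odd p" "small_digits p g k" "t \<le> Suc (top_index p g k)"
  shows "carry p g k t \<le> g"
  using assms(5)
proof (induction t)
  case (Suc t)
  hence "carry p g k (Suc t) < g" by (intro carry_Suc_less[OF assms(1-4)]) auto
  thus ?case by simp
qed simp

text \<open>The two inequalities in the \<open>THE\<close> characterize the quotient by
  \<open>p\<close>, and \<open>carry_Suc_less\<close> provides the bound
  \<open>m < g\<close>.\<close>

lemma shift_coeff_eq_carry:
  assumes "1 \<le> g" "2 * g + 1 \<le> p" "odd p" "small_digits p g k" "t \<le> Suc (top_index p g k)"
  shows "shift_coeff p g k t = carry p g k t"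
  using assms(5)
proof (induction t)
  case (Suc t)
  let ?n = "tuple_sum g (digit_tuple p k t) + carry p g k t"
  have eq: "shift_coeff p g k t = carry p g k t" using Suc by simp
  have iff: "0 \<le> int (tuple_sum g (digit_tuple p k t)) + int (carry p g k t) - int m * int p \<and>
      int (tuple_sum g (digit_tuple p k t)) + int (carry p g k t) - int m * int p < int p
      \<longleftrightarrow> m = carry p g k (Suc t)" for m
  proof -
    have "0 \<le> int (tuple_sum g (digit_tuple p k t)) + int (carry p g k t) - int m * int p \<and>
      int (tuple_sum g (digit_tuple p k t)) + int (carry p g k t) - int m * int p < int p
      \<longleftrightarrow> m * p \<le> ?n \<and> ?n < Suc m * p"
      by (simp add: algebra_simps flip: of_nat_mult of_nat_add)
    also have "\<dots> \<longleftrightarrow> m = ?n div p"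
    proof
      assume "m * p \<le> ?n \<and> ?n < Suc m * p"
      thus "m = ?n div p" by (intro div_nat_eqI[symmetric]) (auto simp: mult.commute)
    next
      have "?n div p * p + ?n mod p = ?n" "?n mod p < p"
        using assms(2) by auto
      thus "m * p \<le> ?n \<and> ?n < Suc m * p" if "m = ?n div p"
        unfolding that mult_Suc by linarith
    qed
    finally show ?thesis by simp
  qed
  have "carry p g k (Suc t) < g"
    using Suc.prems carry_le[OF assms(1-4), of t] by (intro carry_Suc_less[OF assms(1-4)]) auto
  thus ?case
    unfolding shift_coeff.simps(2) eq using iff by (intro the_equality) auto
qed simp

subsection \<open>The congruence\<close>

lemma Const_mult: "Const (a * b) = Const a * Const b"
  by (simp add: Const_def mult_single)

lemma Const_1 [simp]: "Const 1 = 1"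
  by (simp add: Const_def)

lemma Const_add: "Const (a + b) = Const a + Const b"
  by (simp add: Const_def single_add)

lemma Const_0 [simp]: "Const 0 = 0"
  by (simp add: Const_def)

lemma Const_uminus: "Const (- a) = - Const a"
  by (simp add: Const_def single_uminus)

lemma Const_diff: "Const (a - b) = Const a - Const b"
  by (simp add: Const_def single_diff)

lemma Const_power: "Const (a ^ n) = Const a ^ n"
  by (induction n) (simp_all add: Const_mult)

lemma Const_of_nat: "Const (of_nat n) = of_nat n"
  by (induction n) (simp_all add: Const_add)

lemma Const_prod: "Const (\<Prod>t\<in>A. f t) = (\<Prod>t\<in>A. Const (f t))"
  by (induction A rule: infinite_finite_induct) (simp_all add: Const_mult)

text \<open>The scalar of \<open>C_term\<close>; with \<open>s = g\<close> it also serves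
  \<open>K_term\<close>, up to the weight.\<close>

definition C_const :: "nat \<Rightarrow> nat \<Rightarrow> nat \<Rightarrow> nat \<Rightarrow> (nat \<Rightarrow>\<^sub>0 nat) \<Rightarrow> 'p::prime_card mod_ring" where
  "C_const p g r s l =
     (- 1) ^ ((p - 1) div 2 + r * p - s) *
     of_nat (((p - 1) div 2) choose (tuple_sum g l + s - r * p)) *
     of_nat (\<Prod>i\<in>idx g. ((p - 1) div 2) choose (Poly_Mapping.lookup l i))"

lemma C_term_eq:
  "C_term p g r s l x = Const (C_const p g r s l) * (\<Prod>i\<in>idx g. x i ^ Poly_Mapping.lookup l i)"
  unfolding C_term_def C_const_def
  by (simp only: Const_mult Const_power Const_uminus Const_1 Const_of_nat)

lemma K_term_eq:
  "(K_term p g r l x j :: 'p::prime_card Fp_poly) =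
     Const (C_const p g r g l * of_int (L_weight g l j)) * (\<Prod>i\<in>idx g. x i ^ Poly_Mapping.lookup l i)"
proof -
  have "Const (of_int (L_weight g l j)) =
      (if j = 1 then 1
       else if j = 2 then - 2 * of_nat (tuple_sum g l) - 2 * of_nat g
       else 2 * of_nat (Poly_Mapping.lookup l j) + 1 :: 'p Fp_poly)"
  proof -
    have two: "Const 2 = (2 :: 'p Fp_poly)"
      using Const_of_nat[of 2] by simp
    show ?thesis
      by (simp add: L_weight_def Const_add Const_mult Const_uminus Const_diff Const_of_nat two algebra_simps)
  qed
  thus ?thesis
    unfolding K_term_def C_const_def
    by (simp only: Const_mult Const_power Const_uminus Const_1 Const_of_nat mult_ac)
qed

lemma minus_one_power_eq_iff_parity:
  "even (m + n) \<Longrightarrow> (- 1 :: 'a::ring_1) ^ m = (- 1) ^ n"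
  by (simp add: minus_one_power_iff)

text \<open>
  Since \<open>d + S \<equiv> m\<^sub>t - m\<^sub>t\<^sub>+\<^sub>1 p\<close> modulo 2 for the digit \<open>d\<close> of \<open>N\<close> and the digit sum \<open>S\<close>, the signs of the
  reductions \<open>(-1) ^ n * binom h n\<close> combine to the sign of \<open>C\<close> up to \<open>(-1) ^ h\<close>.
\<close>

lemma digit_central_eq_C_const:
  assumes "2 < CARD('p)" "carry CARD('p) g k t \<le> (CARD('p) - 1) div 2"
  shows "(digit_central g k t :: 'p::prime_card mod_ring) = (- 1) ^ ((CARD('p) - 1) div 2) *
     C_const CARD('p) g (carry CARD('p) g k (Suc t)) (carry CARD('p) g k t) (digit_tuple CARD('p) k t)"
proof -
  let ?p = "CARD('p)"
  let ?h = "(?p - 1) div 2"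
  let ?S = "tuple_sum g (digit_tuple ?p k t)" and ?d = "sum_digit ?p g k t"
  let ?m = "carry ?p g k t" and ?m' = "carry ?p g k (Suc t)"
  have d: "?d + ?m' * ?p = ?S + ?m" by (rule sum_digit_plus_carry)
  hence d': "?S + ?m - ?m' * ?p = ?d" by linarith
  have k_i: "(\<Prod>i\<in>idx g. central (digit ?p (Poly_Mapping.lookup k i) t) :: 'p mod_ring) =
      (- 1) ^ ?S * of_nat (\<Prod>i\<in>idx g. ?h choose (digit ?p (Poly_Mapping.lookup k i) t))"
    by (simp add: central_eq_choose[OF assms(1) digit_less_CARD] prod.distrib power_sum tuple_sum_def)
  have N: "(central ?d :: 'p mod_ring) = (- 1) ^ ?d * of_nat (?h choose ?d)"
    by (rule central_eq_choose[OF assms(1) sum_digit_less_CARD])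
  have sign: "(- 1 :: 'p mod_ring) ^ (?d + ?S) = (- 1) ^ (?h + (?h + ?m' * ?p - ?m))"
  proof (rule minus_one_power_eq_iff_parity)
    have "even (b + s + (h + (h + q - n)))" if "b + q = s + n" "n \<le> h" for b q s n h :: nat
    proof -
      have "b + s + (h + (h + q - n)) = 2 * (s + h)" using that by arith
      thus ?thesis by (simp only: dvd_triv_left)
    qed
    from this[OF d assms(2)] show "even (?d + ?S + (?h + (?h + ?m' * ?p - ?m)))" .
  qed
  have "(digit_central g k t :: 'p mod_ring) = (- 1) ^ (?d + ?S) * (of_nat (?h choose ?d) *
      of_nat (\<Prod>i\<in>idx g. ?h choose (digit ?p (Poly_Mapping.lookup k i) t)))"
    unfolding digit_central_def k_i N by (simp only: power_add mult_ac)
  thus ?thesis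
    unfolding sign C_const_def d' lookup_digit_tuple by (simp only: power_add mult_ac)
qed

text \<open>Digit \<open>t\<close> of an exponent counts factors \<open>Var i ^ (p ^ t)\<close>,
  which is why \<open>C_term\<close> is evaluated at these powers.\<close>

lemma prod_Var_digits:
  assumes "1 < p"
  shows "(\<Prod>i\<in>idx g. Var i ^ Poly_Mapping.lookup k i) =
     (\<Prod>t\<le>top_index p g k. \<Prod>i\<in>idx g. ((Var i :: 'p::prime_card Fp_poly) ^ (p ^ t)) ^
        digit p (Poly_Mapping.lookup k i) t)"
proof -
  have "Var i ^ Poly_Mapping.lookup k i =
      (\<Prod>t\<le>top_index p g k. ((Var i :: 'p Fp_poly) ^ (p ^ t)) ^ digit p (Poly_Mapping.lookup k i) t)"
    if "i \<in> idx g" for i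
    by (subst lookup_eq_sum_digits[OF assms that, of k])
      (simp add: power_sum mult.commute flip: power_mult)
  thus ?thesis by (subst prod.swap) simp
qed

text \<open>The weights are affine in the entries, and an entry is congruent to its lowest
  digit.\<close>

lemma of_int_L_weight_digit_tuple:
  "(of_int (L_weight g k j) :: 'p::prime_card mod_ring) =
     of_int (L_weight g (digit_tuple CARD('p) k 0) j)"
proof -
  have *: "(of_nat (digit CARD('p) n 0) :: 'p mod_ring) = of_nat n" for n
    by (simp add: digit_def of_nat_eq_iff_cong_CHAR cong_def)
  have "(of_nat (tuple_sum g (digit_tuple CARD('p) k 0)) :: 'p mod_ring) = of_nat (tuple_sum g k)"
    by (simp add: tuple_sum_def *)
  thus ?thesis by (simp add: L_weight_def *)
qed

lemma sum_digit_int: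
  "int (tuple_sum g (digit_tuple p k t)) + int (carry p g k t) - int (carry p g k (Suc t)) * int p =
     int (sum_digit p g k t)"
  using arg_cong[OF sum_digit_plus_carry[of p g k t], of int] by simp

theorem theorem7p3:
  fixes g p a :: nat and k :: "nat \<Rightarrow>\<^sub>0 nat" and m :: "nat \<Rightarrow> nat"
  assumes "1 \<le> g"
    and "p = CARD('p::prime_card)"
    and "2 * g + 1 \<le> p"
    and "Poly_Mapping.keys k \<subseteq> idx g"
    and "a = top_index p g k"
    and "m = shift_coeff p g k"
  shows "(\<forall>j\<in>{1..2 * g + 1}. has_power_series_at_0 (idx g) (L_fun g j) (\<lambda>k'. L_coeff g k' j))
    \<and> (\<forall>j\<in>{1..2 * g + 1}. L_coeff g k j \<in> Z_half)
    \<and> ((\<exists>j\<in>{1..2 * g + 1}. (reduce (L_coeff g k j) :: 'p mod_ring) \<noteq> 0) \<longleftrightarrow> admissible p g k)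
    \<and> (admissible p g k \<longleftrightarrow>
         small_digits p g k \<and> (\<forall>j\<le>a. digit_tuple p k j \<in> Delta p g (m (j + 1)) (m j)))
    \<and> (admissible p g k \<longrightarrow>
         (\<forall>j\<in>{1..2 * g + 1}.
            Const (reduce (L_coeff g k j) :: 'p mod_ring) * (\<Prod>i\<in>idx g. Var i ^ Poly_Mapping.lookup k i)
            = Const (scalar_factor p a (m (a + 1))) *
              (\<Prod>t\<in>{1..a}. C_term p g (m (t + 1)) (m t) (digit_tuple p k t) (\<lambda>i. Var i ^ (p ^ t))) *
              K_term p g (m 1) (digit_tuple p k 0) Var j))"
proof -
  let ?h = "(p - 1) div 2"
  have p2: "2 < CARD('p)" "2 < p" "1 < p" using assms(1-3) by auto
  have "prime p" using assms(2) prime_card by blast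
  hence "odd p" using p2(2) prime_odd_nat by blast
  have gh: "g \<le> ?h" using assms(3) by simp
  note hyps = assms(1,3) \<open>odd p\<close>
  have m: "m t = carry p g k t" if "small_digits p g k" "t \<le> Suc a" for t
    using shift_coeff_eq_carry[OF hyps that(1)] that(2) assms(5,6) by simp
  have L: "(reduce (L_coeff g k j) :: 'p mod_ring) =
      (\<Prod>t\<le>a. digit_central g k t) * central (carry p g k (Suc a)) * of_int (L_weight g k j)"
    if "j \<in> {1..2 * g + 1}" for j
    unfolding L_coeff_eq[OF assms(1) that assms(4)] reduce_L_coeff_val[OF p2(1)] central_product_eq
    by (simp only: assms(2,5))
  have adm: "admissible p g k \<longleftrightarrow> small_digits p g k \<and> (\<forall>t\<le>a. sum_digit p g k t \<le> ?h)"
  proof -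
    have "int (tuple_sum g (digit_tuple p k t)) - int (shift_coeff p g k (t + 1)) * int p
        + int (shift_coeff p g k t) = int (sum_digit p g k t)" if "small_digits p g k" "t \<le> a" for t
      using m[of t] m[of "Suc t"] that sum_digit_int[of g p k t] assms(6) by simp
    thus ?thesis by (auto simp: admissible_def assms(5))
  qed
  have digit_central_nz: "(digit_central g k t :: 'p mod_ring) \<noteq> 0 \<longleftrightarrow>
      sum_digit p g k t \<le> ?h \<and> (\<forall>i\<in>idx g. digit p (Poly_Mapping.lookup k i) t \<le> ?h)" for t
    unfolding digit_central_def assms(2)
    by (simp add: central_neq_0_iff[OF p2(1) sum_digit_less_CARD]
        central_neq_0_iff[OF p2(1) digit_less_CARD])
  have small: "small_digits p g k \<longleftrightarrow> (\<forall>t\<le>a. \<forall>i\<in>idx g. digit p (Poly_Mapping.lookup k i) t \<le> ?h)"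
    by (auto simp: small_digits_def assms(5))
  \<comment> \<open>The last carry is at most \<open>g\<close>, hence at most
    \<open>(p - 1) div 2\<close>, where \<open>central\<close> does not vanish.\<close>
  have last_nz: "(central (carry p g k (Suc a)) :: 'p mod_ring) \<noteq> 0" if "small_digits p g k"
  proof -
    have "carry p g k (Suc a) \<le> ?h"
      using carry_le[OF hyps that, of "Suc a"] gh assms(5) by simp
    thus ?thesis
      using p2(1) assms(2) by (subst central_neq_0_iff) auto
  qed
  have prod_nz: "(\<Prod>t\<le>a. digit_central g k t :: 'p mod_ring) \<noteq> 0 \<longleftrightarrow> admissible p g k"
    unfolding adm small by (auto simp: digit_central_nz)

  have "has_power_series_at_0 (idx g) (L_fun g j) (\<lambda>k'. L_coeff g k' j)" if "j \<in> {1..2 * g + 1}" for j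
    by (rule has_power_series_at_0_transfer[OF L_fun_power_series[OF assms(1) that], of 1])
      (use L_coeff_eq[OF assms(1) that] in auto)
  moreover have "L_coeff g k j \<in> Z_half" if "j \<in> {1..2 * g + 1}" for j
    unfolding L_coeff_eq[OF assms(1) that assms(4)] L_coeff_val_eq Z_half_def by blast
  moreover have "(\<exists>j\<in>{1..2 * g + 1}. (reduce (L_coeff g k j) :: 'p mod_ring) \<noteq> 0) \<longleftrightarrow> admissible p g k"
  proof
    assume "\<exists>j\<in>{1..2 * g + 1}. (reduce (L_coeff g k j) :: 'p mod_ring) \<noteq> 0"
    hence "(\<Prod>t\<le>a. digit_central g k t :: 'p mod_ring) \<noteq> 0" by (auto simp: L)
    thus "admissible p g k" using prod_nz by blast
  next
    assume A: "admissible p g k"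
    \<comment> \<open>The first coordinate is a witness because its weight is 1.\<close>
    have "(reduce (L_coeff g k 1) :: 'p mod_ring) \<noteq> 0"
      using A prod_nz last_nz adm by (simp add: L L_weight_def del: carry.simps)
    thus "\<exists>j\<in>{1..2 * g + 1}. (reduce (L_coeff g k j) :: 'p mod_ring) \<noteq> 0"
      by (intro bexI[of _ 1]) auto
  qed
  moreover have "admissible p g k \<longleftrightarrow>
      small_digits p g k \<and> (\<forall>j\<le>a. digit_tuple p k j \<in> Delta p g (m (j + 1)) (m j))"
  proof -
    \<comment> \<open>Once the digits are small, the quantity bounded in \<open>Delta\<close> is the
      digit of \<open>N\<close> at position \<open>t\<close>.\<close>
    have "digit_tuple p k t \<in> Delta p g (m (t + 1)) (m t) \<longleftrightarrow> sum_digit p g k t \<le> ?h"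
      if "small_digits p g k" "t \<le> a" for t
    proof -
      have "Poly_Mapping.keys (digit_tuple p k t) \<subseteq> idx g"
        using keys_digit_tuple assms(4) by blast
      moreover have "\<forall>i\<in>idx g. digit p (Poly_Mapping.lookup k i) t \<le> ?h"
        using that small by blast
      moreover have "int (tuple_sum g (digit_tuple p k t)) + int (m t) - int (m (t + 1)) * int p =
          int (sum_digit p g k t)"
        using m[of t] m[of "Suc t"] that sum_digit_int[of g p k t] by simp
      ultimately show ?thesis by (simp add: Delta_def)
    qed
    thus ?thesis unfolding adm by blast
  qed
  moreover have "Const (reduce (L_coeff g k j) :: 'p mod_ring) * (\<Prod>i\<in>idx g. Var i ^ Poly_Mapping.lookup k i)
      = Const (scalar_factor p a (m (a + 1))) *
        (\<Prod>t\<in>{1..a}. C_term p g (m (t + 1)) (m t) (digit_tuple p k t) (\<lambda>i. Var i ^ (p ^ t))) *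
        K_term p g (m 1) (digit_tuple p k 0) Var j"
    if A: "admissible p g k" and j: "j \<in> {1..2 * g + 1}" for j
  proof -
    have small_k: "small_digits p g k" using A adm by blast
    let ?c = "\<lambda>t. C_const p g (m (t + 1)) (m t) (digit_tuple p k t) :: 'p mod_ring"
    let ?v = "\<lambda>t. \<Prod>i\<in>idx g. ((Var i :: 'p Fp_poly) ^ (p ^ t)) ^ digit p (Poly_Mapping.lookup k i) t"
    have "(digit_central g k t :: 'p mod_ring) = (- 1) ^ ?h * ?c t" if "t \<le> a" for t
    proof -
      have "carry p g k t \<le> ?h"
        using carry_le[OF hyps small_k, of t] that gh assms(5) by simp
      thus ?thesis
        using digit_central_eq_C_const[OF p2(1), of g k t] m[OF small_k, of t]
          m[OF small_k, of "Suc t"] that assms(2) by simp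
    qed
    hence "(\<Prod>t\<le>a. digit_central g k t :: 'p mod_ring) = (\<Prod>t\<le>a. (- 1) ^ ?h * ?c t)"
      by (intro prod.cong) auto
    \<comment> \<open>One sign for each of the \<open>a + 1\<close> positions, including position 0,
      which becomes \<open>K_term\<close>.\<close>
    also have "\<dots> = (- 1) ^ ((a + 1) * ?h) * (\<Prod>t\<le>a. ?c t)"
      by (simp add: prod.distrib power_add mult.commute flip: power_mult)
    finally have dc: "(\<Prod>t\<le>a. digit_central g k t :: 'p mod_ring) =
        (- 1) ^ ((a + 1) * ?h) * (\<Prod>t\<le>a. ?c t)" .
    have sf: "(scalar_factor p a (m (a + 1)) :: 'p mod_ring) =
        (- 1) ^ ((a + 1) * ?h) * central (carry p g k (Suc a))"
      using m[OF small_k, of "Suc a"] by (simp add: scalar_factor_def central_def)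
    have split: "(\<Prod>t\<le>a. f t) = f 0 * (\<Prod>t\<in>{1..a}. f t)" for f :: "nat \<Rightarrow> 'b::comm_monoid_mult"
    proof -
      have "{..a} = insert 0 {1..a}" by auto
      thus ?thesis by simp
    qed
    have w: "(of_int (L_weight g k j) :: 'p mod_ring) = of_int (L_weight g (digit_tuple p k 0) j)"
      using of_int_L_weight_digit_tuple assms(2) by simp
    have "(reduce (L_coeff g k j) :: 'p mod_ring) = scalar_factor p a (m (a + 1)) *
        (\<Prod>t\<in>{1..a}. ?c t) * (?c 0 * of_int (L_weight g (digit_tuple p k 0) j))"
      unfolding L[OF j] dc sf split[of ?c] w by (simp only: mult_ac)
    moreover have "(\<Prod>i\<in>idx g. (Var i :: 'p Fp_poly) ^ Poly_Mapping.lookup k i) =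
        ?v 0 * (\<Prod>t\<in>{1..a}. ?v t)"
      unfolding prod_Var_digits[OF p2(3)] assms(5)[symmetric] by (rule split)
    \<comment> \<open>This identifies the scalar at position 0 with the one in
      \<open>K_term\<close>.\<close>
    moreover have "m 0 = g" using assms(6) by simp
    ultimately show ?thesis
      unfolding C_term_eq K_term_eq lookup_digit_tuple prod.distrib
      by (simp add: Const_mult Const_prod mult_ac)
  qed
  ultimately show ?thesis by blast
qed

end
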